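(* There is an online algorithm whose competitive ratio is at most $211$ for the submodular matroid secretary problem on laminar matroids. That is, there is an online algorithm such that for every laminar matroid $(U,\mathcal{I})$ and every non-negative, monotonically non-decreasing submodular function $f:2^U\to\mathbb{R}_{\ge 0}$, the accepted set $\mathrm{ALG}$ is always independent and satisfies $\mathbb{E}[f(\mathrm{ALG})]\ge \frac{1}{211}\max_{T\in\mathcal{I}} f(T)$.
   Context: Submodular matroid secretary problem: $U$ is a finite ground set and $(U,\mathcal{I})$ is a matroid known to the algorithm. An adversary fixes a non-negative, monotonically non-decreasing submodular function $f:2^U\to\mathbb{R}_{\ge 0}$ (submodular: $f(S)+f(T)\ge f(S\cup T)+f(S\cap T)$ for all $S,T\subseteq U$). The elements of $U$ then arrive one at a time in a uniformly random order. The algorithm may query $f(T)$ only for sets $T$ of elements that have already arrived. When an element arrives, the algorithm must immediately and irrevocably decide whether to accept it, and the set $\mathrm{ALG}$ of accepted elements must always be in $\mathcal{I}$. The algorithm is $C$-competitive (has competitive ratio at most $C$) if for every $f$, $\mathbb{E}[f(\mathrm{ALG})]\ge \frac{1}{C}\max_{T\in\mathcal{I}}f(T)$, where the expectation is over the random arrival order and the algorithm's internal randomness. Laminar matroid: a family $\mathcal{F}=\{B_1,\dots,B_\ell\}$ of subsets of $U$ is laminar if for any two members either they are disjoint or one contains the other. Each $B_i$ has a capacity $\mu(B_i)$ (a non-negative integer). The laminar matroid has independent sets $\mathcal{I}=\{T\subseteq U: |T\cap B_i|\le \mu(B_i)\ \forall i\}$. *)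

theory Defs
  imports "HOL-Probability.Probability" "HOL-Combinatorics.Multiset_Permutations"
begin

definition laminar_family :: "'a set \<Rightarrow> 'a set set \<Rightarrow> bool" where
  "laminar_family U F \<longleftrightarrow> finite F \<and> (\<forall>B\<in>F. B \<subseteq> U) \<and>
     (\<forall>A\<in>F. \<forall>B\<in>F. A \<inter> B = {} \<or> A \<subseteq> B \<or> B \<subseteq> A)"

definition laminar_indep :: "'a set \<Rightarrow> 'a set set \<Rightarrow> ('a set \<Rightarrow> nat) \<Rightarrow> 'a set set" where
  "laminar_indep U F mu = {T. T \<subseteq> U \<and> (\<forall>B\<in>F. card (T \<inter> B) \<le> mu B)}"

definition nonneg_monotone_submodular :: "'a set \<Rightarrow> ('a set \<Rightarrow> real) \<Rightarrow> bool" where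
  "nonneg_monotone_submodular U f \<longleftrightarrow>
     (\<forall>S. S \<subseteq> U \<longrightarrow> 0 \<le> f S) \<and>
     (\<forall>S T. S \<subseteq> T \<and> T \<subseteq> U \<longrightarrow> f S \<le> f T) \<and>
     (\<forall>S T. S \<subseteq> U \<and> T \<subseteq> U \<longrightarrow> f S + f T \<ge> f (S \<union> T) + f (S \<inter> T))"

text \<open>An online algorithm (behavioural strategy): at each arrival it receives the
  matroid description (U, F, mu), the list of elements arrived so far (the last one
  being the current element), the value oracle restricted to subsets of arrived
  elements, and its own previously accepted set; it returns the (random) decision
  whether to accept the current element.\<close>
type_synonym 'a online_alg =
  "'a set \<Rightarrow> 'a set set \<Rightarrow> ('a set \<Rightarrow> nat) \<Rightarrow> 'a list \<Rightarrow> ('a set \<Rightarrow> real) \<Rightarrow> 'a set \<Rightarrow> bool pmf"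

fun run_online :: "'a online_alg \<Rightarrow> 'a set \<Rightarrow> 'a set set \<Rightarrow> ('a set \<Rightarrow> nat) \<Rightarrow>
    ('a set \<Rightarrow> real) \<Rightarrow> 'a list \<Rightarrow> 'a set \<Rightarrow> 'a list \<Rightarrow> 'a set pmf" where
  "run_online alg U F mu f seen A [] = return_pmf A"
| "run_online alg U F mu f seen A (x # xs) =
     do { b \<leftarrow> alg U F mu (seen @ [x]) (restrict f (Pow (set (seen @ [x])))) A;
          run_online alg U F mu f (seen @ [x]) (if b then insert x A else A) xs }"

definition alg_outcome :: "'a online_alg \<Rightarrow> 'a set \<Rightarrow> 'a set set \<Rightarrow> ('a set \<Rightarrow> nat) \<Rightarrow>
    ('a set \<Rightarrow> real) \<Rightarrow> 'a set pmf" where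
  "alg_outcome alg U F mu f =
     pmf_of_set (permutations_of_set U) \<bind> (\<lambda>xs. run_online alg U F mu f [] {} xs)"

end

theory Submission
  imports Defs
begin

text \<open>
  The algorithm rejects the first \<open>m\<close> elements, \<open>m\<close> binomial with \<open>p = 24/25\<close>, so that they form a
  sample \<open>H\<close> containing each element independently with probability \<open>p\<close>. A later element \<open>u\<close> is
  accepted if it would be used by the greedy algorithm on \<open>H \<union> {u}\<close> and independence is kept.
  This simulates one greedy run on \<open>U\<close>: each considered element is put into the greedy solution
  \<open>M\<close> with probability \<open>p\<close> and otherwise into the set \<open>N\<close> of elements that the algorithm would like
  to accept, independently of the past. Hence \<open>E f(M)\<close> is at least half the optimum, and the
  marginal values of \<open>N\<close> over \<open>M \<union> N\<close> amount to the fraction \<open>1 - p\<close> of \<open>E f(M \<union> N)\<close>.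
  What is lost lies in sets \<open>B\<close> with \<open>|N \<inter> B| > \<mu>(B)\<close> although \<open>|M \<inter> B| \<le> \<mu>(B)\<close>. As marginal values
  decrease along the run, an exponential-moment bound shows that such a \<open>B\<close> costs at most a
  fraction of order \<open>2^(-\<mu>(B))\<close> of the value considered in \<open>B\<close>, and the relevant sets
  containing a fixed element have distinct capacities.
\<close>

section \<open>Independent random subsets\<close>

text \<open>A finite weighted sum instead of a \<open>pmf\<close>, so that the coin of a single
  element can be split off by plain algebra.\<close>

definition sample_exp :: "real \<Rightarrow> 'a set \<Rightarrow> ('a set \<Rightarrow> real) \<Rightarrow> real" where
  "sample_exp p R \<phi> = (\<Sum>H\<in>Pow R. p ^ card H * (1 - p) ^ card (R - H) * \<phi> H)"

text \<open>Deferred decisions: the weights are products, so once the coin of \<open>u\<close> is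
  fixed the rest is again an independent sample, now of \<open>R - {u}\<close>.\<close>

lemma sample_exp_remove:
  assumes "finite R" "u \<in> R"
  shows "sample_exp p R \<phi> =
    p * sample_exp p (R - {u}) (\<lambda>H. \<phi> (insert u H)) + (1 - p) * sample_exp p (R - {u}) \<phi>"
proof -
  let ?Q = "R - {u}"
  have fQ: "finite ?Q" using assms by simp
  have R: "R = insert u ?Q" using assms by auto
  have Pow: "Pow R = Pow ?Q \<union> insert u ` Pow ?Q"
    using arg_cong[OF R, of Pow] unfolding Pow_insert .
  have disj: "Pow ?Q \<inter> insert u ` Pow ?Q = {}" by auto
  have inj: "inj_on (insert u) (Pow ?Q)" by (auto simp: inj_on_def)
  have 1: "p ^ card H * (1 - p) ^ card (R - H) * \<phi> H
      = (1 - p) * (p ^ card H * (1 - p) ^ card (?Q - H) * \<phi> H)" if "H \<in> Pow ?Q" for H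
  proof -
    have "R - H = insert u (?Q - H)" using that assms by auto
    then have "card (R - H) = Suc (card (?Q - H))" using fQ by simp
    then show ?thesis by simp
  qed
  have 2: "p ^ card (insert u H) * (1 - p) ^ card (R - insert u H) * \<phi> (insert u H)
      = p * (p ^ card H * (1 - p) ^ card (?Q - H) * \<phi> (insert u H))" if "H \<in> Pow ?Q" for H
  proof -
    have "R - insert u H = ?Q - H" by auto
    moreover have "card (insert u H) = Suc (card H)"
      using that fQ by (subst card_insert_disjoint) (auto intro: finite_subset)
    ultimately show ?thesis by simp
  qed
  have "sample_exp p R \<phi> = (\<Sum>H\<in>Pow ?Q. p ^ card H * (1 - p) ^ card (R - H) * \<phi> H)
     + (\<Sum>H\<in>insert u ` Pow ?Q. p ^ card H * (1 - p) ^ card (R - H) * \<phi> H)"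
    unfolding sample_exp_def Pow using fQ disj by (intro sum.union_disjoint) auto
  also have "(\<Sum>H\<in>insert u ` Pow ?Q. p ^ card H * (1 - p) ^ card (R - H) * \<phi> H)
     = (\<Sum>H\<in>Pow ?Q. p * (p ^ card H * (1 - p) ^ card (?Q - H) * \<phi> (insert u H)))"
    by (subst sum.reindex[OF inj]) (use 2 in \<open>auto intro!: sum.cong\<close>)
  also have "(\<Sum>H\<in>Pow ?Q. p ^ card H * (1 - p) ^ card (R - H) * \<phi> H)
     = (\<Sum>H\<in>Pow ?Q. (1 - p) * (p ^ card H * (1 - p) ^ card (?Q - H) * \<phi> H))"
    using 1 by (intro sum.cong) auto
  finally show ?thesis
    unfolding sample_exp_def by (simp add: sum_distrib_left)
qed

lemma sample_exp_const: "finite R \<Longrightarrow> sample_exp p R (\<lambda>_. c) = c"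
proof (induction R rule: finite_induct)
  case empty
  then show ?case by (simp add: sample_exp_def)
next
  case (insert x F)
  then have "insert x F - {x} = F" by auto
  then show ?case using insert
    by (subst sample_exp_remove[where u = x]) (auto simp: algebra_simps)
qed

lemma sample_exp_add: "sample_exp p R (\<lambda>H. \<phi> H + \<psi> H) = sample_exp p R \<phi> + sample_exp p R \<psi>"
  by (simp add: sample_exp_def algebra_simps sum.distrib)

lemma sample_exp_cmult: "sample_exp p R (\<lambda>H. c * \<phi> H) = c * sample_exp p R \<phi>"
  by (simp add: sample_exp_def sum_distrib_left algebra_simps)

lemma sample_exp_diff: "sample_exp p R (\<lambda>H. \<phi> H - \<psi> H) = sample_exp p R \<phi> - sample_exp p R \<psi>"
  by (simp add: sample_exp_def algebra_simps sum_subtractf)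

lemma sample_exp_sum:
  "sample_exp p R (\<lambda>H. \<Sum>i\<in>I. \<phi> i H) = (\<Sum>i\<in>I. sample_exp p R (\<phi> i))"
  unfolding sample_exp_def sum_distrib_left by (rule sum.swap)

lemma sample_exp_mono:
  assumes "0 \<le> p" "p \<le> 1" "\<And>H. H \<subseteq> R \<Longrightarrow> \<phi> H \<le> \<psi> H"
  shows "sample_exp p R \<phi> \<le> sample_exp p R \<psi>"
  unfolding sample_exp_def using assms by (intro sum_mono mult_left_mono) auto

lemma sample_exp_cong:
  assumes "\<And>H. H \<subseteq> R \<Longrightarrow> \<phi> H = \<psi> H"
  shows "sample_exp p R \<phi> = sample_exp p R \<psi>"
  unfolding sample_exp_def using assms by (intro sum.cong) auto

section \<open>Prefixes of binomial length in a random order\<close>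

lemma card_permutations_with_prefix_set:
  assumes "finite U" "H \<subseteq> U"
  shows "card {xs \<in> permutations_of_set U. set (take (card H) xs) = H}
    = fact (card H) * fact (card U - card H)"
proof -
  have fH: "finite H" "finite (U - H)" using assms by (auto intro: finite_subset)
  have "bij_betw (\<lambda>(ys, zs). ys @ zs) (permutations_of_set H \<times> permutations_of_set (U - H))
      {xs \<in> permutations_of_set U. set (take (card H) xs) = H}"
  proof (rule bij_betw_byWitness[where f' = "\<lambda>xs. (take (card H) xs, drop (card H) xs)"], goal_cases)
    case 1
    then show ?case by (auto simp: permutations_of_set_def distinct_card)
  next
    case 2
    then show ?case by auto
  next
    case 3
    then show ?case using assms by (auto simp: permutations_of_set_def distinct_card)
  next
    case 4
    have "set (drop (card H) xs) = U - H"
      if "distinct xs" "set xs = U" "set (take (card H) xs) = H" for xs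
    proof -
      have "distinct (take (card H) xs @ drop (card H) xs)" using that(1) by simp
      then have "set (take (card H) xs) \<inter> set (drop (card H) xs) = {}"
        unfolding distinct_append by blast
      moreover have "set (take (card H) xs) \<union> set (drop (card H) xs) = U"
        using that(2) by (metis append_take_drop_id set_append)
      ultimately show ?thesis using that(3) by blast
    qed
    then show ?case by (auto simp: permutations_of_set_def)
  qed
  then have "card {xs \<in> permutations_of_set U. set (take (card H) xs) = H}
     = card (permutations_of_set H \<times> permutations_of_set (U - H))"
    by (simp add: bij_betw_same_card)
  also have "\<dots> = fact (card H) * fact (card U - card H)"
    using fH assms by (simp add: card_cartesian_product card_Diff_subset)
  finally show ?thesis .
qed

text \<open>In a uniformly random order the first \<open>m\<close> elements form a uniform
  \<open>m\<close>-subset, and the size of an independent sample is binomial. So drawing the single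
  number \<open>m\<close> is all the randomness that the algorithm needs.\<close>

lemma binomial_prefix_expectation:
  assumes fin: "finite U" and p: "0 \<le> p" "p \<le> 1"
  shows "measure_pmf.expectation (pmf_of_set (permutations_of_set U))
      (\<lambda>xs. measure_pmf.expectation (binomial_pmf (card U) p) (\<lambda>m. \<phi> (set (take m xs))))
    = sample_exp p U \<phi>"
proof -
  let ?n = "card U" and ?P = "permutations_of_set U"
  have fP: "finite ?P" "?P \<noteq> {}" using fin by auto
  have cP: "card ?P = fact ?n" using fin by simp
  have bin: "measure_pmf.expectation (binomial_pmf ?n p) g
      = (\<Sum>m\<le>?n. real (?n choose m) * p ^ m * (1 - p) ^ (?n - m) * g m)" for g :: "nat \<Rightarrow> real"
    using p by (subst integral_measure_pmf[where A = "{..?n}"])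
      (auto simp: set_pmf_binomial_eq split: if_splits)
  have avg: "(\<Sum>xs\<in>?P. \<phi> (set (take m xs)))
      = fact m * fact (?n - m) * (\<Sum>H | H \<subseteq> U \<and> card H = m. \<phi> H)" if "m \<le> ?n" for m
  proof -
    let ?S = "{H. H \<subseteq> U \<and> card H = m}"
    have maps: "set (take m xs) \<in> ?S" if "xs \<in> ?P" for xs
      using that \<open>m \<le> ?n\<close> set_take_subset[of m xs]
      by (auto simp: permutations_of_set_def distinct_card)
    have "(\<Sum>xs\<in>?P. \<phi> (set (take m xs)))
        = (\<Sum>H\<in>?S. \<Sum>xs | xs \<in> ?P \<and> set (take m xs) = H. \<phi> (set (take m xs)))"
      using fP fin maps by (intro sum.group[symmetric]) auto
    also have "\<dots> = (\<Sum>H\<in>?S. fact m * fact (?n - m) * \<phi> H)"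
    proof (intro sum.cong refl)
      fix H assume H: "H \<in> ?S"
      have "(\<Sum>xs | xs \<in> ?P \<and> set (take m xs) = H. \<phi> (set (take m xs)))
          = (\<Sum>xs | xs \<in> ?P \<and> set (take m xs) = H. \<phi> H)" by (intro sum.cong) auto
      then show "(\<Sum>xs | xs \<in> ?P \<and> set (take m xs) = H. \<phi> (set (take m xs)))
          = fact m * fact (?n - m) * \<phi> H"
        using card_permutations_with_prefix_set[OF fin, of H] H by simp
    qed
    finally show ?thesis by (simp add: sum_distrib_left)
  qed
  \<comment> \<open>The \<open>m! (n - m)!\<close> orders behind each subset turn the binomial
    coefficient into \<open>n!\<close>, which cancels against the number of all orders.\<close>
  have w: "real (?n choose m) * fact m * fact (?n - m) = fact ?n" if "m \<le> ?n" for m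
    using binomial_fact[OF that, where ?'a = real] by simp
  have "measure_pmf.expectation (pmf_of_set ?P)
      (\<lambda>xs. measure_pmf.expectation (binomial_pmf ?n p) (\<lambda>m. \<phi> (set (take m xs))))
    = (\<Sum>xs\<in>?P. \<Sum>m\<le>?n. real (?n choose m) * p ^ m * (1 - p) ^ (?n - m) * \<phi> (set (take m xs))) / fact ?n"
    using fP by (subst integral_pmf_of_set) (auto simp: bin cP)
  also have "(\<Sum>xs\<in>?P. \<Sum>m\<le>?n. real (?n choose m) * p ^ m * (1 - p) ^ (?n - m) * \<phi> (set (take m xs)))
    = (\<Sum>m\<le>?n. real (?n choose m) * p ^ m * (1 - p) ^ (?n - m) * (\<Sum>xs\<in>?P. \<phi> (set (take m xs))))"
    by (subst sum.swap) (simp add: sum_distrib_left)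
  also have "\<dots> = (\<Sum>m\<le>?n. fact ?n * (p ^ m * (1 - p) ^ (?n - m) * (\<Sum>H | H \<subseteq> U \<and> card H = m. \<phi> H)))"
  proof (intro sum.cong refl)
    fix m assume m: "m \<in> {..?n}"
    have "real (?n choose m) * p ^ m * (1 - p) ^ (?n - m) * (\<Sum>xs\<in>?P. \<phi> (set (take m xs)))
      = (real (?n choose m) * fact m * fact (?n - m)) *
         (p ^ m * (1 - p) ^ (?n - m) * (\<Sum>H | H \<subseteq> U \<and> card H = m. \<phi> H))"
      using m by (subst avg) (simp_all only: atMost_iff ac_simps)
    also have "\<dots> = fact ?n * (p ^ m * (1 - p) ^ (?n - m) * (\<Sum>H | H \<subseteq> U \<and> card H = m. \<phi> H))"
      using m w by simp
    finally show "real (?n choose m) * p ^ m * (1 - p) ^ (?n - m) * (\<Sum>xs\<in>?P. \<phi> (set (take m xs))) = \<dots>" .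
  qed
  also have "\<dots> / fact ?n = (\<Sum>m\<le>?n. p ^ m * (1 - p) ^ (?n - m) * (\<Sum>H | H \<subseteq> U \<and> card H = m. \<phi> H))"
    by (simp add: sum_distrib_left[symmetric])
  also have "\<dots> = (\<Sum>m\<le>?n. \<Sum>H | H \<in> Pow U \<and> card H = m. p ^ card H * (1 - p) ^ card (U - H) * \<phi> H)"
    unfolding sum_distrib_left using fin
    by (intro sum.cong refl) (auto simp: card_Diff_subset finite_subset)
  also have "\<dots> = sample_exp p U \<phi>"
    unfolding sample_exp_def using fin by (intro sum.group) (auto intro: card_mono)
  finally show ?thesis .
qed

section \<open>Realising a random seed by a behavioural strategy\<close>

type_synonym 'a decision_rule = "'a list \<Rightarrow> ('a set \<Rightarrow> real) \<Rightarrow> 'a set \<Rightarrow> bool"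

primrec run_det ::
  "'a decision_rule \<Rightarrow> ('a set \<Rightarrow> real) \<Rightarrow> 'a list \<Rightarrow> 'a set \<Rightarrow> 'a list \<Rightarrow> 'a set" where
  "run_det D f seen A [] = A"
| "run_det D f seen A (x # xs) =
    run_det D f (seen @ [x])
      (if D (seen @ [x]) (restrict f (Pow (set (seen @ [x])))) A then insert x A else A) xs"

text \<open>The strategy resamples the seed from its posterior given its past decisions, which
  are recoverable from the arrival list and the accepted set.\<close>

definition posterior_alg :: "'s pmf \<Rightarrow> ('s \<Rightarrow> 'a decision_rule) \<Rightarrow>
    'a list \<Rightarrow> ('a set \<Rightarrow> real) \<Rightarrow> 'a set \<Rightarrow> bool pmf" where
  "posterior_alg P D ys g A =
    map_pmf (\<lambda>s. D s ys g A) (cond_pmf P {s. run_det (D s) g [] {} (butlast ys) = A})"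

lemma run_det_subset: "run_det D f ys A xs \<subseteq> A \<union> set xs"
proof (induction xs arbitrary: ys A)
  case (Cons x xs)
  show ?case using Cons[of "ys @ [x]" "insert x A"] Cons[of "ys @ [x]" A] by auto
qed simp

lemma run_det_append:
  "run_det D f ys A (xs @ zs) = run_det D f (ys @ xs) (run_det D f ys A xs) zs"
  by (induction xs arbitrary: ys A) auto

lemma run_det_cong:
  assumes "\<And>T. T \<subseteq> set ys \<union> set xs \<Longrightarrow> f T = g T"
  shows "run_det D f ys A xs = run_det D g ys A xs"
  using assms
proof (induction xs arbitrary: ys A)
  case (Cons x xs)
  have "restrict f (Pow (set (ys @ [x]))) = restrict g (Pow (set (ys @ [x])))"
    using Cons.prems by (intro restrict_ext) auto
  moreover have "run_det D f (ys @ [x]) B xs = run_det D g (ys @ [x]) B xs" for B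
    using Cons.prems by (intro Cons.IH) auto
  ultimately show ?case by simp
qed simp

lemma cond_pmf_cond_pmf:
  assumes "set_pmf P \<inter> K \<inter> L \<noteq> {}"
  shows "cond_pmf (cond_pmf P K) L = cond_pmf P (K \<inter> L)"
proof (rule pmf_eqI)
  fix i
  have ne1: "set_pmf P \<inter> K \<noteq> {}" using assms by blast
  have ne: "set_pmf P \<inter> K \<noteq> {}" "set_pmf (cond_pmf P K) \<inter> L \<noteq> {}" "set_pmf P \<inter> (K \<inter> L) \<noteq> {}"
    unfolding set_cond_pmf[OF ne1] using assms by blast+
  have pos: "measure P K \<noteq> 0"
    using ne(1) by (simp add: measure_pmf_zero_iff)
  have "measure (cond_pmf P K) L = measure P (K \<inter> L) / measure P K"
  proof -
    have "measure (cond_pmf P K) L = measure (uniform_measure P K) L"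
      by (simp add: cond_pmf.rep_eq[OF ne(1)])
    also have "\<dots> = measure P (K \<inter> L) / measure P K"
      using pos by (subst measure_uniform_measure) (auto simp: measure_pmf.emeasure_eq_measure)
    finally show ?thesis .
  qed
  then show "pmf (cond_pmf (cond_pmf P K) L) i = pmf (cond_pmf P (K \<inter> L)) i"
    using pos by (simp add: pmf_cond[OF ne(2)] pmf_cond[OF ne(1)] pmf_cond[OF ne(3)])
qed

text \<open>Law of total probability: a decision drawn from its marginal, followed by a seed drawn
  from the posterior, restores the distribution of the seed.\<close>

lemma bind_map_cond_pmf: "bind_pmf (map_pmf g Q) (\<lambda>b. cond_pmf Q {s. g s = b}) = Q"
proof (rule bind_cond_pmf_cancel)
  fix b assume "b \<in> set_pmf (map_pmf g Q)"
  then show "set_pmf Q \<inter> {s. g s = b} \<noteq> {}" by auto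
next
  fix y assume "y \<in> set_pmf Q"
  then show "set_pmf (map_pmf g Q) \<inter> {x. g y = x} \<noteq> {}" by auto
next
  fix x y assume "x \<in> set_pmf (map_pmf g Q)" "y \<in> set_pmf Q" "g y = x"
  then show "measure Q {y. g y = x} = measure (map_pmf g Q) {x. g y = x}"
    by (auto simp: vimage_def intro!: arg_cong[where f = "measure Q"])
qed

text \<open>Invariant along the arrivals: given the history, the seed follows its prior conditioned
  on the accepted set. The non-emptiness assumption says that \<open>A\<close> is reachable, as
  \<open>cond_pmf\<close> is meaningful only then.\<close>

lemma run_online_posterior_alg_aux:
  assumes "\<And>seen g A. alg U F mu seen g A = posterior_alg P D seen g A"
    and "distinct (ys @ xs)" and "set_pmf P \<inter> {s. run_det (D s) f [] {} ys = A} \<noteq> {}"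
  shows "run_online alg U F mu f ys A xs =
    map_pmf (\<lambda>s. run_det (D s) f ys A xs) (cond_pmf P {s. run_det (D s) f [] {} ys = A})"
  using assms(2,3)
proof (induction xs arbitrary: ys A)
  case Nil
  then show ?case by (simp add: map_pmf_const)
next
  case (Cons x xs)
  let ?K = "{s. run_det (D s) f [] {} ys = A}"
  let ?ys = "ys @ [x]"
  let ?g = "restrict f (Pow (set ?ys))"
  let ?d = "\<lambda>s. D s ?ys ?g A"
  let ?A = "\<lambda>b. if b then insert x A else A"
  let ?Q = "cond_pmf P ?K"
  have x: "x \<notin> set ys" using Cons.prems by simp
  have sub: "run_det (D s) f [] {} ys \<subseteq> set ys" for s
    using run_det_subset[of "D s" f "[]" "{}" ys] by simp
  have xA: "x \<notin> A" using Cons.prems(2) sub x by blast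
  \<comment> \<open>Past decisions consulted only sets of arrived elements, so the restricted oracle
    suffices to replay them.\<close>
  have "run_det (D s) ?g [] {} ys = run_det (D s) f [] {} ys" for s
    by (rule run_det_cong) auto
  then have alg: "alg U F mu ?ys ?g A = map_pmf ?d ?Q"
    by (simp add: assms(1) posterior_alg_def del: set_append)
  \<comment> \<open>Since \<open>x\<close> is new, the accepted set after its arrival encodes both
    the previous accepted set and the decision.\<close>
  have K: "{s. run_det (D s) f [] {} ?ys = ?A b} = ?K \<inter> {s. ?d s = b}" for b
  proof -
    have "run_det (D s) f [] {} ?ys = ?A b \<longleftrightarrow> run_det (D s) f [] {} ys = A \<and> ?d s = b" for s
    proof -
      have "x \<notin> run_det (D s) f [] {} ys" using x sub by blast
      then show ?thesis
        using xA insert_ident[of x "run_det (D s) f [] {} ys" A]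
        by (cases b) (auto simp: run_det_append split: if_splits)
    qed
    then show ?thesis by blast
  qed
  have IH: "run_online alg U F mu f ?ys (?A b) xs
      = map_pmf (\<lambda>s. run_det (D s) f ys A (x # xs)) (cond_pmf ?Q {s. ?d s = b})"
    if b: "b \<in> set_pmf (map_pmf ?d ?Q)" for b
  proof -
    have ne: "set_pmf P \<inter> ?K \<inter> {s. ?d s = b} \<noteq> {}"
      using b Cons.prems(2) by (auto simp: set_cond_pmf)
    then have "run_online alg U F mu f ?ys (?A b) xs
      = map_pmf (\<lambda>s. run_det (D s) f ?ys (?A b) xs) (cond_pmf P (?K \<inter> {s. ?d s = b}))"
      using Cons.prems(1) by (subst Cons.IH) (auto simp only: K Int_assoc distinct_append append_assoc append_Cons append_Nil)
    also have "\<dots> = map_pmf (\<lambda>s. run_det (D s) f ys A (x # xs)) (cond_pmf P (?K \<inter> {s. ?d s = b}))"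
      using ne by (intro map_pmf_cong refl) (auto simp: set_cond_pmf Int_assoc)
    finally show ?thesis by (simp only: cond_pmf_cond_pmf[OF ne])
  qed
  have "run_online alg U F mu f ys A (x # xs) =
      bind_pmf (map_pmf ?d ?Q) (\<lambda>b. run_online alg U F mu f ?ys (?A b) xs)"
    using alg by simp
  also have "\<dots> = bind_pmf (map_pmf ?d ?Q)
      (\<lambda>b. map_pmf (\<lambda>s. run_det (D s) f ys A (x # xs)) (cond_pmf ?Q {s. ?d s = b}))"
    using IH by (intro bind_pmf_cong refl)
  also have "\<dots> = map_pmf (\<lambda>s. run_det (D s) f ys A (x # xs)) ?Q"
    by (simp only: map_bind_pmf[symmetric] bind_map_cond_pmf)
  finally show ?case .
qed

lemma run_online_posterior_alg:
  assumes "\<And>seen g A. alg U F mu seen g A = posterior_alg P D seen g A" and "distinct xs"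
  shows "run_online alg U F mu f [] {} xs = map_pmf (\<lambda>s. run_det (D s) f [] {} xs) P"
proof -
  have "cond_pmf P UNIV = P"
    by (intro pmf_eqI) (simp add: pmf_cond set_pmf_not_empty)
  then show ?thesis
    using run_online_posterior_alg_aux[of alg U F mu P D "[]" xs f "{}"] assms
    by (simp add: set_pmf_not_empty)
qed

section \<open>The simulated greedy process\<close>

context
  fixes ind :: "'a set \<Rightarrow> bool" and idx :: "'a \<Rightarrow> nat" and f :: "'a set \<Rightarrow> real"
begin

definition cand :: "'a set \<Rightarrow> 'a set \<Rightarrow> 'a set" where
  "cand M R = {u \<in> R. ind (insert u M)}"

text \<open>Ties are broken by \<open>idx\<close>. With \<open>idx\<close> injective the choice is
  unique and survives the removal of other candidates (\<open>best_eqI\<close>), which the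
  simulation on a smaller ground set relies on.\<close>

definition is_best :: "'a set \<Rightarrow> 'a set \<Rightarrow> 'a \<Rightarrow> bool" where
  "is_best M C u \<longleftrightarrow> u \<in> C \<and> (\<forall>v\<in>C. f (insert v M) < f (insert u M) \<or>
     f (insert v M) = f (insert u M) \<and> idx u \<le> idx v)"

definition best :: "'a set \<Rightarrow> 'a set \<Rightarrow> 'a" where
  "best M C = (SOME u. is_best M C u)"

lemma is_best_best:
  assumes "finite C" "C \<noteq> {}"
  shows "is_best M C (best M C)"
proof -
  let ?m = "Max ((\<lambda>v. f (insert v M)) ` C)"
  let ?D = "{v \<in> C. f (insert v M) = ?m}"
  have "?m \<in> (\<lambda>v. f (insert v M)) ` C" using assms by (intro Max_in) auto
  then have "?D \<noteq> {}" by auto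
  then obtain u where u: "u \<in> ?D" "\<And>v. v \<in> ?D \<Longrightarrow> idx u \<le> idx v"
    using ex_has_least_nat[of "\<lambda>v. v \<in> ?D" _ idx] by blast
  have "f (insert v M) \<le> ?m" if "v \<in> C" for v using assms that by simp
  then have "is_best M C u" unfolding is_best_def using u by force
  then show ?thesis unfolding best_def by (rule someI)
qed

lemma best_in_cand: "finite R \<Longrightarrow> cand M R \<noteq> {} \<Longrightarrow> best M (cand M R) \<in> cand M R"
  using is_best_best[of "cand M R" M] by (auto simp: is_best_def cand_def)

text \<open>The sets in an entry are those before its step; the label tells whether the element was sampled.\<close>

function trace :: "'a set \<Rightarrow> 'a set \<Rightarrow> 'a set \<Rightarrow> 'a set \<Rightarrow> ('a set \<times> 'a set \<times> 'a \<times> bool) list" where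
  "trace M N R H =
    (if finite R \<and> cand M R \<noteq> {} then
       (let u = best M (cand M R) in
         (M, N, u, u \<in> H) #
           (if u \<in> H then trace (insert u M) N (R - {u}) H else trace M (insert u N) (R - {u}) H))
     else [])"
  by auto
termination
proof (relation "Wellfounded.measure (\<lambda>(M, N, R, H). card R)", goal_cases)
  case (2 M N R H x)
  then have "x \<in> R" using best_in_cand[of R M] by (simp add: cand_def)
  then show ?case using 2 card_Diff1_less[of R x] by simp
next
  case (3 M N R H x)
  then have "x \<in> R" using best_in_cand[of R M] by (simp add: cand_def)
  then show ?case using 3 card_Diff1_less[of R x] by simp
qed auto

declare trace.simps [simp del]

lemma trace_stop: "\<not> (finite R \<and> cand M R \<noteq> {}) \<Longrightarrow> trace M N R H = []"
  by (subst trace.simps) (simp only: if_False)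

lemma trace_step:
  "finite R \<Longrightarrow> cand M R \<noteq> {} \<Longrightarrow> u = best M (cand M R) \<Longrightarrow>
   trace M N R H = (M, N, u, u \<in> H) #
     (if u \<in> H then trace (insert u M) N (R - {u}) H else trace M (insert u N) (R - {u}) H)"
  by (subst trace.simps) (simp add: Let_def)

lemma trace_cong_sample: "H \<inter> R = H' \<inter> R \<Longrightarrow> trace M N R H = trace M N R H'"
proof (induction M N R H rule: trace.induct)
  case (1 M N R H)
  show ?case
  proof (cases "finite R \<and> cand M R \<noteq> {}")
    case True
    define u where "u = best M (cand M R)"
    have u: "u \<in> R" using True best_in_cand[of R M] by (auto simp: u_def cand_def)
    have "u \<in> H \<longleftrightarrow> u \<in> H'" "H \<inter> (R - {u}) = H' \<inter> (R - {u})" using u 1(3) by blast+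
    then show ?thesis
      using 1(1,2)[OF True u_def] True by (simp add: trace_step[OF _ _ u_def])
  next
    case False
    then show ?thesis by (simp add: trace_stop)
  qed
qed

definition picked :: "bool \<Rightarrow> ('a set \<times> 'a set \<times> 'a \<times> bool) list \<Rightarrow> 'a set" where
  "picked b l = {u. \<exists>M N. (M, N, u, b) \<in> set l}"

lemma picked_simps [simp]:
  "picked b [] = {}"
  "picked b ((M, N, u, b') # l) = (if b' = b then insert u (picked b l) else picked b l)"
  by (auto simp: picked_def)

lemma picked_trace_subset: "picked b (trace M N R H) \<subseteq> {u \<in> R. (u \<in> H) = b}"
proof (induction M N R H rule: trace.induct)
  case (1 M N R H)
  show ?case
  proof (cases "finite R \<and> cand M R \<noteq> {}")
    case True
    define u where "u = best M (cand M R)"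
    have u: "u \<in> R" using True best_in_cand[of R M] by (auto simp: u_def cand_def)
    then show ?thesis
      using 1(1,2)[OF True u_def] True by (auto simp: trace_step[OF _ _ u_def])
  next
    case False
    then show ?thesis by (simp add: trace_stop)
  qed
qed

lemma is_best_unique:
  "inj_on idx C \<Longrightarrow> is_best M C u \<Longrightarrow> is_best M C v \<Longrightarrow> u = v"
  by (force simp: is_best_def dest: inj_onD)

lemma best_eqI:
  assumes "finite C" "inj_on idx C" "D \<subseteq> C" "best M C \<in> D"
  shows "best M D = best M C"
proof -
  have "is_best M C (best M C)" using assms by (intro is_best_best) auto
  then have "is_best M D (best M C)" using assms by (auto simp: is_best_def)
  moreover have "is_best M D (best M D)"
    using assms by (intro is_best_best) (auto intro: finite_subset)
  ultimately show ?thesis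
    using assms by (intro is_best_unique[of D M]) (auto intro: inj_on_subset)
qed

text \<open>The online algorithm knows only the sample and the current element, so it
  evaluates the left-hand side of this equivalence.\<close>

lemma rejected_restrict_ground:
  assumes "inj_on idx R" "finite R" "u \<in> R'" "H \<inter> R \<subseteq> R'" "R' \<subseteq> R" "u \<notin> H"
  shows "u \<in> picked False (trace M N' R' H) \<longleftrightarrow> u \<in> picked False (trace M N R H)"
  using assms
proof (induction "card R" arbitrary: M N N' R R' rule: less_induct)
  case less
  have fin': "finite R'" using less.prems by (auto intro: finite_subset)
  have sub: "cand M R' \<subseteq> cand M R" using less.prems by (auto simp: cand_def)
  show ?case
  proof (cases "cand M R = {}")
    case True
    then show ?thesis using sub by (simp add: trace_stop)
  next
    case False
    define v where "v = best M (cand M R)"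
    have v: "v \<in> cand M R" using best_in_cand[of R M] False less.prems by (simp add: v_def)
    then have vR: "v \<in> R" by (simp add: cand_def)
    have inj: "inj_on idx (R - {v})" using less.prems(1) by (rule inj_on_subset) auto
    have card: "card (R - {v}) < card R" using vR less.prems by (intro card_Diff1_less) auto
    note step = trace_step[OF less.prems(2) False v_def]
    show ?thesis
    proof (cases "v \<in> R'")
      case True
      then have v': "v \<in> cand M R'" using v by (simp add: cand_def)
      have fC: "finite (cand M R)" using less.prems(2) by (simp add: cand_def)
      have "inj_on idx (cand M R)" using less.prems(1) by (rule inj_on_subset) (auto simp: cand_def)
      then have "v = best M (cand M R')"
        using best_eqI[OF fC _ sub] v' unfolding v_def by simp
      note step' = trace_step[OF fin' _ this]
      have ne: "cand M R' \<noteq> {}" using v' by auto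
      have IH: "u \<in> picked False (trace M1 N1 (R' - {v}) H) \<longleftrightarrow> u \<in> picked False (trace M1 N2 (R - {v}) H)"
        if "u \<noteq> v" for M1 N1 N2
        using less.prems that by (intro less.hyps[OF card inj]) auto
      show ?thesis
        using less.prems(6) IH by (cases "u = v") (auto simp: step step'[OF ne])
    next
      case False
      \<comment> \<open>An element missing from \<open>R'\<close> lies outside the sample, so the
        larger run merely adds it to \<open>N\<close>, and \<open>N\<close> never influences a
        choice.\<close>
      then have "v \<notin> H" "u \<noteq> v" using less.prems vR by auto
      moreover have "u \<in> picked False (trace M N' R' H) \<longleftrightarrow> u \<in> picked False (trace M (insert v N) (R - {v}) H)"
        using less.prems False by (intro less.hyps[OF card inj]) auto
      ultimately show ?thesis by (simp add: step)
    qed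
  qed
qed

end

lemma trace_cong_value:
  assumes "\<And>T. T \<subseteq> M \<union> R \<Longrightarrow> f T = g T"
  shows "trace ind idx f M N R H = trace ind idx g M N R H"
  using assms
proof (induction M N R H rule: trace.induct[where ind = ind and idx = idx and f = f])
  case (1 M N R H)
  show ?case
  proof (cases "finite R \<and> cand ind M R \<noteq> {}")
    case True
    have "is_best idx f M (cand ind M R) = is_best idx g M (cand ind M R)"
      unfolding is_best_def using 1(3) by (intro ext conj_cong ball_cong refl) (auto simp: cand_def)
    then have eq: "best idx g M (cand ind M R) = best idx f M (cand ind M R)" by (simp add: best_def)
    define u where "u = best idx f M (cand ind M R)"
    have u: "u \<in> R" using True best_in_cand[of R ind M idx f] by (auto simp: u_def cand_def)
    have "trace ind idx f (insert u M) N (R - {u}) H = trace ind idx g (insert u M) N (R - {u}) H"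
      if "u \<in> H"
      using 1(3) u by (intro 1(1)[OF True u_def that]) (auto intro!: 1(3))
    moreover have "trace ind idx f M (insert u N) (R - {u}) H = trace ind idx g M (insert u N) (R - {u}) H"
      if "u \<notin> H"
      using 1(3) u by (intro 1(2)[OF True u_def that]) (auto intro!: 1(3))
    ultimately show ?thesis
      using True eq by (simp add: trace_step u_def)
  next
    case False
    then show ?thesis by (simp add: trace_stop)
  qed
qed

section \<open>Costs summed along a run\<close>

definition tsum ::
  "('a set \<Rightarrow> 'a set \<Rightarrow> 'a \<Rightarrow> bool \<Rightarrow> real) \<Rightarrow> ('a set \<times> 'a set \<times> 'a \<times> bool) list \<Rightarrow> real" where
  "tsum c l = (\<Sum>(M, N, u, b)\<leftarrow>l. c M N u b)"

lemma tsum_simps [simp]: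
  "tsum c [] = 0"
  "tsum c ((M, N, u, b) # l) = c M N u b + tsum c l"
  by (simp_all add: tsum_def)

lemma tsum_mono:
  "(\<And>M N u b. (M, N, u, b) \<in> set l \<Longrightarrow> c M N u b \<le> c' M N u b) \<Longrightarrow> tsum c l \<le> tsum c' l"
  unfolding tsum_def by (rule sum_list_mono) auto

lemma tsum_diff: "tsum (\<lambda>M N u b. c M N u b - c' M N u b) l = tsum c l - tsum c' l"
  by (induction l) auto

lemma tsum_sum: "tsum (\<lambda>M N u b. \<Sum>i\<in>I. c i M N u b * r i) l = (\<Sum>i\<in>I. tsum (c i) l * r i)"
  by (induction l) (auto simp: sum.distrib algebra_simps)

lemma sum_half_powers_le:
  assumes "finite A" "0 \<notin> A"
  shows "(\<Sum>k\<in>A. (1 / 2) ^ k) \<le> (1 :: real)"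
proof -
  have "(\<Sum>k\<in>A. (1 / 2) ^ k) \<le> (\<Sum>k\<in>{1..Max (insert 0 A)}. (1 / 2 :: real) ^ k)"
    using assms by (intro sum_mono2) (auto simp: Suc_le_eq intro: gr0I)
  moreover have "(\<Sum>k\<in>{1..n}. (1 / 2 :: real) ^ k) = 1 - (1 / 2) ^ n" for n
    by (induction n) auto
  moreover have "0 \<le> (1 / 2 :: real) ^ n" for n by simp
  ultimately show ?thesis by (smt (verit))
qed

section \<open>The run on a fixed laminar instance\<close>

locale laminar_process =
  fixes U :: "'a set" and F :: "'a set set" and mu :: "'a set \<Rightarrow> nat"
    and f :: "'a set \<Rightarrow> real" and idx :: "'a \<Rightarrow> nat" and p :: real
  assumes fin_U: "finite U" and laminar: "laminar_family U F"
    and nms: "nonneg_monotone_submodular U f" and inj_idx: "inj_on idx U"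
    and p: "0 \<le> p" "p \<le> 1"
begin

abbreviation "ind \<equiv> \<lambda>T. T \<in> laminar_indep U F mu"
abbreviation "cnd \<equiv> cand ind"
abbreviation "run \<equiv> trace ind idx f"

definition gain :: "'a set \<Rightarrow> 'a \<Rightarrow> real" where
  "gain M u = f (insert u M) - f M"

lemma f_mono: "S \<subseteq> T \<Longrightarrow> T \<subseteq> U \<Longrightarrow> f S \<le> f T"
  using nms by (simp add: nonneg_monotone_submodular_def)

lemma f_nonneg: "S \<subseteq> U \<Longrightarrow> 0 \<le> f S"
  using nms by (simp add: nonneg_monotone_submodular_def)

lemma gain_nonneg: "M \<subseteq> U \<Longrightarrow> u \<in> U \<Longrightarrow> 0 \<le> gain M u"
  using f_mono[of M "insert u M"] by (simp add: gain_def subset_insertI)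

text \<open>Diminishing returns: submodularity for \<open>insert u A\<close> and \<open>B\<close>.
  If \<open>u\<close> is already in \<open>B\<close>, its gain over \<open>B\<close> is
  zero.\<close>

lemma gain_antimono:
  assumes "A \<subseteq> B" "B \<subseteq> U" "u \<in> U"
  shows "gain B u \<le> gain A u"
proof (cases "u \<in> B")
  case True
  then show ?thesis using assms gain_nonneg[of A u] by (simp add: gain_def insert_absorb)
next
  case False
  have "f (insert u A \<union> B) + f (insert u A \<inter> B) \<le> f (insert u A) + f B"
    using nms assms unfolding nonneg_monotone_submodular_def
    by (metis insert_subset order.trans)
  moreover have "insert u A \<union> B = insert u B" "insert u A \<inter> B = A" using False assms by auto
  ultimately show ?thesis by (simp add: gain_def)
qed

lemma indep_subset:
  assumes "ind T" "S \<subseteq> T"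
  shows "ind S"
proof -
  have T: "T \<subseteq> U" "\<And>B. B \<in> F \<Longrightarrow> card (T \<inter> B) \<le> mu B"
    using assms(1) by (auto simp: laminar_indep_def)
  have "card (S \<inter> B) \<le> card (T \<inter> B)" for B
    using assms(2) T(1) fin_U by (intro card_mono) (auto intro: finite_subset)
  then show ?thesis
    using T assms(2) unfolding laminar_indep_def by (blast intro: order.trans)
qed

text \<open>\<open>R\<close> holds the undecided elements; disjointness makes each considered
  element new, so that cardinalities grow by exactly one.\<close>

definition state :: "'a set \<Rightarrow> 'a set \<Rightarrow> 'a set \<Rightarrow> bool" where
  "state M N R \<longleftrightarrow> M \<subseteq> U \<and> N \<subseteq> U \<and> R \<subseteq> U \<and> M \<inter> R = {} \<and> N \<inter> R = {}"

definition considers :: "'a set \<Rightarrow> 'a set \<Rightarrow> 'a \<Rightarrow> bool" where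
  "considers M R u \<longleftrightarrow> cnd M R \<noteq> {} \<and> u = best idx f M (cnd M R)"

lemma state_finite: "state M N R \<Longrightarrow> finite M \<and> finite N \<and> finite R"
  using fin_U by (auto simp: state_def intro: finite_subset)

lemma considersD:
  assumes "state M N R" "considers M R u"
  shows "u \<in> R" "u \<in> U" "u \<notin> M" "u \<notin> N" "ind (insert u M)" "M \<subseteq> U" "N \<subseteq> U"
    "v \<in> cnd M R \<Longrightarrow> gain M v \<le> gain M u"
    "state (insert u M) N (R - {u})" "state M (insert u N) (R - {u})"
proof -
  have fR: "finite R" using assms state_finite by blast
  have b: "is_best idx f M (cnd M R) u"
    using assms(2) fR is_best_best[of "cnd M R" idx f M] by (auto simp: considers_def cand_def)
  then have u: "u \<in> cnd M R" by (simp add: is_best_def)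
  show "u \<in> R" "u \<in> U" "u \<notin> M" "u \<notin> N" "ind (insert u M)" "M \<subseteq> U" "N \<subseteq> U"
    using u assms(1) by (auto simp: cand_def state_def)
  then show "state (insert u M) N (R - {u})" "state M (insert u N) (R - {u})"
    using assms(1) by (auto simp: state_def)
  show "v \<in> cnd M R \<Longrightarrow> gain M v \<le> gain M u" using b by (auto simp: is_best_def gain_def)
qed

text \<open>Induction over the tree of coin tosses: both outcomes for \<open>u\<close> are available
  as hypotheses, matching the recursion \<open>path_exp_step\<close>.\<close>

lemma process_induct [consumes 1, case_names stop step]:
  assumes "state M N R"
    and "\<And>M N R. state M N R \<Longrightarrow> cnd M R = {} \<Longrightarrow> P M N R"
    and "\<And>M N R u. state M N R \<Longrightarrow> considers M R u \<Longrightarrow>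
      P (insert u M) N (R - {u}) \<Longrightarrow> P M (insert u N) (R - {u}) \<Longrightarrow> P M N R"
  shows "P M N R"
  using assms(1)
proof (induction "card R" arbitrary: M N R rule: less_induct)
  case less
  show ?case
  proof (cases "cnd M R = {}")
    case True
    then show ?thesis using assms(2) less.prems by blast
  next
    case False
    then have c: "considers M R (best idx f M (cnd M R))" by (simp add: considers_def)
    note d = considersD[OF less.prems c]
    have "card (R - {best idx f M (cnd M R)}) < card R"
      using d(1) state_finite[OF less.prems] by (intro card_Diff1_less) auto
    then show ?thesis using d(9,10) by (intro assms(3)[OF less.prems c] less.hyps)
  qed
qed

lemma run_step:
  "state M N R \<Longrightarrow> considers M R u \<Longrightarrow> run M N R H = (M, N, u, u \<in> H) #
     (if u \<in> H then run (insert u M) N (R - {u}) H else run M (insert u N) (R - {u}) H)"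
  using state_finite[of M N R] by (intro trace_step) (auto simp: considers_def)

section \<open>Expectations over the coin tosses of a run\<close>

definition path_exp ::
  "(('a set \<times> 'a set \<times> 'a \<times> bool) list \<Rightarrow> real) \<Rightarrow> 'a set \<Rightarrow> 'a set \<Rightarrow> 'a set \<Rightarrow> real" where
  "path_exp \<phi> M N R = sample_exp p R (\<lambda>H. \<phi> (run M N R H))"

lemma path_exp_stop: "state M N R \<Longrightarrow> cnd M R = {} \<Longrightarrow> path_exp \<phi> M N R = \<phi> []"
  using state_finite by (simp add: path_exp_def trace_stop sample_exp_const)

text \<open>The coin of \<open>u\<close> is read only when \<open>u\<close> is considered;
  afterwards the run looks only at \<open>R - {u}\<close>, whose coins are still fresh.\<close>

lemma path_exp_step:
  assumes "state M N R" "considers M R u"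
  shows "path_exp \<phi> M N R = p * path_exp (\<lambda>l. \<phi> ((M, N, u, True) # l)) (insert u M) N (R - {u})
    + (1 - p) * path_exp (\<lambda>l. \<phi> ((M, N, u, False) # l)) M (insert u N) (R - {u})"
proof -
  have "run (insert u M) N (R - {u}) (insert u H) = run (insert u M) N (R - {u}) H" for H
    by (rule trace_cong_sample) auto
  then have "sample_exp p (R - {u}) (\<lambda>H. \<phi> (run M N R (insert u H)))
      = path_exp (\<lambda>l. \<phi> ((M, N, u, True) # l)) (insert u M) N (R - {u})"
    unfolding path_exp_def by (simp add: run_step[OF assms])
  moreover have "sample_exp p (R - {u}) (\<lambda>H. \<phi> (run M N R H))
      = path_exp (\<lambda>l. \<phi> ((M, N, u, False) # l)) M (insert u N) (R - {u})"
    unfolding path_exp_def by (intro sample_exp_cong) (auto simp: run_step[OF assms])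
  ultimately show ?thesis
    using considersD(1)[OF assms] state_finite[OF assms(1)]
    by (subst path_exp_def, subst sample_exp_remove[where u = u]) auto
qed

lemma path_exp_const_add:
  "state M N R \<Longrightarrow> path_exp (\<lambda>l. c + \<psi> l) M N R = c + path_exp \<psi> M N R"
  using state_finite by (simp add: path_exp_def sample_exp_add sample_exp_const)

lemma path_exp_tsum_step:
  assumes "state M N R" "considers M R u"
  shows "path_exp (tsum c) M N R =
    p * (c M N u True + path_exp (tsum c) (insert u M) N (R - {u})) +
    (1 - p) * (c M N u False + path_exp (tsum c) M (insert u N) (R - {u}))"
  using considersD(9,10)[OF assms]
  by (simp add: path_exp_step[OF assms] path_exp_const_add[of _ _ _ _ "tsum c"])

lemma path_exp_tsum_nonneg:
  assumes "state M N R" and "\<And>M N u b. M \<subseteq> U \<Longrightarrow> u \<in> U \<Longrightarrow> 0 \<le> c M N u b"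
  shows "0 \<le> path_exp (tsum c) M N R"
  using assms(1)
proof (induction rule: process_induct)
  case (stop M N R)
  then show ?case by (simp add: path_exp_stop)
next
  case (step M N R u)
  then show ?case
    using p assms(2) considersD(2,6)[OF step(1,2)] by (simp add: path_exp_tsum_step)
qed

text \<open>The label of an element is independent of the state in which it is considered.\<close>

lemma path_exp_label:
  assumes "state M N R"
  shows "path_exp (tsum (\<lambda>M N u b. if b = b0 then c M N u else 0)) M N R =
    (if b0 then p else 1 - p) * path_exp (tsum (\<lambda>M N u b. c M N u)) M N R"
  using assms
proof (induction rule: process_induct)
  case (stop M N R)
  then show ?case by (simp add: path_exp_stop)
next
  case (step M N R u)
  then show ?case
    by (simp add: path_exp_tsum_step algebra_simps)
qed

subsection \<open>The greedy value\<close>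

text \<open>Every violated set contains \<open>u\<close> and is tight for
  \<open>M \<union> Z\<close>. Let \<open>B\<close> be a smallest one. As \<open>M\<close> together
  with \<open>u\<close> fits, some \<open>z\<close> of \<open>Z\<close> outside \<open>M\<close>
  lies in \<open>B\<close>. Violated sets are comparable to \<open>B\<close> because they share
  \<open>u\<close>, hence contain \<open>B\<close> and \<open>z\<close>, so dropping
  \<open>z\<close> repairs all of them.\<close>

lemma laminar_exchange:
  assumes "ind (M \<union> Z)" "ind (insert u M)" "u \<notin> M" "u \<notin> Z"
  shows "ind (insert u (M \<union> Z)) \<or> (\<exists>z\<in>Z. z \<notin> M \<and> ind (insert u (M \<union> (Z - {z}))))"
proof (cases "ind (insert u (M \<union> Z))")
  case not_ind: False
  let ?T = "M \<union> Z"
  have TU: "insert u ?T \<subseteq> U" using assms by (auto simp: laminar_indep_def)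
  have fT: "finite ?T" using finite_subset[OF TU fin_U] by simp
  have fB: "finite B" if "B \<in> F" for B
    using that laminar finite_subset[OF _ fin_U, of B] by (simp add: laminar_family_def)
  let ?V = "{B \<in> F. mu B < card (insert u ?T \<inter> B)}"
  have "?V \<noteq> {}" using not_ind TU by (auto simp: laminar_indep_def not_le)
  then obtain B where B: "B \<in> ?V" and min: "\<And>B'. B' \<in> ?V \<Longrightarrow> card B \<le> card B'"
    using ex_has_least_nat[of "\<lambda>B. B \<in> ?V" _ card] by blast
  have V: "u \<in> B' \<and> card (?T \<inter> B') = mu B'" if "B' \<in> ?V" for B'
  proof -
    have "card (?T \<inter> B') \<le> mu B'" using assms(1) that by (simp add: laminar_indep_def)
    then show ?thesis using that assms(3,4) fT by (cases "u \<in> B'") auto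
  qed
  have "\<exists>z\<in>Z. z \<in> B \<and> z \<notin> M"
  proof (rule ccontr)
    assume "\<not> ?thesis"
    then have "?T \<inter> B = M \<inter> B" by blast
    then have "card (insert u M \<inter> B) = Suc (mu B)"
      using V[OF B] assms(3) fT by simp
    then show False using assms(2) B by (auto simp: laminar_indep_def)
  qed
  then obtain z where z: "z \<in> Z" "z \<in> B" "z \<notin> M" by blast
  let ?S = "insert u (M \<union> (Z - {z}))"
  have "card (?S \<inter> B') \<le> mu B'" if "B' \<in> F" for B'
  proof (cases "B' \<in> ?V")
    case True
    have "B \<subseteq> B' \<or> B' \<subseteq> B"
      using laminar B True V[OF B] V[OF True] unfolding laminar_family_def by blast
    then have "B \<subseteq> B'"
      using min[OF True] card_seteq[OF fB, of B B'] B by auto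
    then have S: "?S \<inter> B' = insert u (?T \<inter> B' - {z})" and zT: "z \<in> ?T \<inter> B'"
      using z V[OF True] assms(4) by auto
    have fT': "finite (?T \<inter> B')" using fT by simp
    have "card (?S \<inter> B') = Suc (card (?T \<inter> B' - {z}))"
      unfolding S using fT' assms(3,4) by (intro card_insert_disjoint) simp_all
    also have "\<dots> = card (?T \<inter> B')"
      using card.remove[OF fT' zT] by simp
    finally have "card (?S \<inter> B') = card (?T \<inter> B')" .
    then show ?thesis using V[OF True] by simp
  next
    case False
    have "card (?S \<inter> B') \<le> card (insert u ?T \<inter> B')" using fT by (intro card_mono) auto
    then show ?thesis using False that by simp
  qed
  then have "ind ?S" using TU by (auto simp: laminar_indep_def)
  then show ?thesis using z by blast
qed blast

text \<open>\<open>Z\<close> is what is left of a reference solution. By the greedy choice, dropping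
  any element of \<open>Z\<close> lowers \<open>f (M \<union> Z)\<close> by at most
  \<open>gain M u\<close>. If \<open>u\<close> is not in \<open>Z\<close>, a drop happens only when
  \<open>u\<close> enters \<open>M\<close>; if \<open>u\<close> is in \<open>Z\<close>, only when
  \<open>u\<close> goes to \<open>N\<close>. So in expectation \<open>f (M \<union> Z)\<close> falls
  by no more than \<open>f M\<close> grows. At the end \<open>Z\<close> is empty and both values
  agree, whence the factor 2.\<close>

lemma greedy_value:
  assumes "1 / 2 \<le> p" "state M N R" "Z \<subseteq> R" "ind (M \<union> Z)"
  shows "f (M \<union> Z) - f M \<le> 2 * (path_exp (\<lambda>l. f (M \<union> picked True l)) M N R - f M)"
  using assms(2-4)
proof (induction arbitrary: Z rule: process_induct)
  case (stop M N R)
  have "ind (insert z M)" if "z \<in> Z" for z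
    by (rule indep_subset[OF stop(4)]) (use that in auto)
  then have "Z \<subseteq> cnd M R" using stop(3) by (auto simp: cand_def)
  then show ?case using stop by (simp add: path_exp_stop)
next
  case (step M N R u)
  note d = considersD[OF step(1,2)]
  let ?E = "\<lambda>M N R. path_exp (\<lambda>l. f (M \<union> picked True l)) M N R"
  have E: "?E M N R = p * ?E (insert u M) N (R - {u}) + (1 - p) * ?E M (insert u N) (R - {u})"
    by (simp add: path_exp_step[OF step(1,2)])
  have ZU: "Z \<subseteq> U" using step(1,5) by (auto simp: state_def)
  have w: "0 \<le> gain M u" using d by (intro gain_nonneg)
  have cz: "gain M z \<le> gain M u" if "z \<in> Z" for z
  proof -
    have "ind (insert z M)" by (rule indep_subset[OF step(6)]) (use that in auto)
    then have "z \<in> cnd M R" using that step(5) by (auto simp: cand_def)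
    then show ?thesis using considersD(8)[OF step(1,2)] by blast
  qed
  have drop: "f (M \<union> Z) - gain M u \<le> f (M \<union> (Z - {z}))" if "z \<in> Z" for z
  proof -
    have "insert z (M \<union> (Z - {z})) = M \<union> Z" using that by auto
    moreover have "gain (M \<union> (Z - {z})) z \<le> gain M z"
      using that ZU d by (intro gain_antimono) auto
    ultimately show ?thesis using cz[OF that] by (simp add: gain_def)
  qed
  have fu: "f (insert u M) = f M + gain M u" by (simp add: gain_def)
  show ?case
  proof (cases "u \<in> Z")
    case True
    have "insert u M \<union> (Z - {u}) = M \<union> Z" using True by auto
    then have 1: "f (M \<union> Z) - f (insert u M) \<le> 2 * (?E (insert u M) N (R - {u}) - f (insert u M))"
      using step(3)[of "Z - {u}"] step(5,6) by auto
    have "f (M \<union> (Z - {u})) - f M \<le> 2 * (?E M (insert u N) (R - {u}) - f M)"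
      by (rule step(4)) (use step(5) in \<open>auto intro: indep_subset[OF step(6)]\<close>)
    then have 2: "f (M \<union> Z) - gain M u - f M \<le> 2 * (?E M (insert u N) (R - {u}) - f M)"
      using drop[OF True] by simp
    \<comment> \<open>Here \<open>1 / 2 \<le> p\<close> enters: \<open>u\<close> must be at least as
      likely to join \<open>M\<close> as to be lost from \<open>Z\<close>.\<close>
    have "gain M u * 1 \<le> gain M u * (2 * p)" using w assms(1) by (intro mult_left_mono) auto
    moreover have "p * (f (M \<union> Z) + gain M u - f M) \<le> p * (2 * (?E (insert u M) N (R - {u}) - f M))"
      using 1 p fu by (intro mult_left_mono) auto
    moreover have "(1 - p) * (f (M \<union> Z) - gain M u - f M) \<le> (1 - p) * (2 * (?E M (insert u N) (R - {u}) - f M))"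
      using 2 p by (intro mult_left_mono) auto
    ultimately show ?thesis unfolding E by (simp add: algebra_simps)
  next
    case False
    obtain Z' where Z': "Z' \<subseteq> Z" "ind (insert u M \<union> Z')" "f (M \<union> Z) - gain M u \<le> f (M \<union> Z')"
    proof (cases "ind (insert u (M \<union> Z))")
      case True
      then show ?thesis using that[of Z] w by simp
    next
      case False
      then obtain z where "z \<in> Z" "ind (insert u (M \<union> (Z - {z})))"
        using laminar_exchange[OF step(6) d(5) d(3) \<open>u \<notin> Z\<close>] by blast
      then show ?thesis using that[of "Z - {z}"] drop[of z] by auto
    qed
    have "f (insert u M \<union> Z') - f (insert u M) \<le> 2 * (?E (insert u M) N (R - {u}) - f (insert u M))"
      by (rule step(3)) (use Z' step(5) False in auto)
    moreover have "f (M \<union> Z') \<le> f (insert u M \<union> Z')" using Z' ZU d by (intro f_mono) auto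
    ultimately have 1: "f (M \<union> Z) - f M \<le> 2 * (?E (insert u M) N (R - {u}) - f M)"
      using Z'(3) fu by simp
    have 2: "f (M \<union> Z) - f M \<le> 2 * (?E M (insert u N) (R - {u}) - f M)"
      by (rule step(4)) (use step(5,6) False in auto)
    have "p * (f (M \<union> Z) - f M) + (1 - p) * (f (M \<union> Z) - f M)
        \<le> p * (2 * (?E (insert u M) N (R - {u}) - f M)) + (1 - p) * (2 * (?E M (insert u N) (R - {u}) - f M))"
      using 1 2 p by (intro add_mono mult_left_mono) auto
    then show ?thesis unfolding E by (simp add: algebra_simps)
  qed
qed

lemma path_exp_tsum_step_unlabelled:
  assumes "state M N R" "considers M R u"
  shows "path_exp (tsum (\<lambda>M N u b. c M N u)) M N R = c M N u +
    (p * path_exp (tsum (\<lambda>M N u b. c M N u)) (insert u M) N (R - {u}) +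
     (1 - p) * path_exp (tsum (\<lambda>M N u b. c M N u)) M (insert u N) (R - {u}))"
  by (simp add: path_exp_tsum_step[OF assms] algebra_simps)

subsection \<open>Overflow of a laminar set\<close>

text \<open>Exponential moment for the race of \<open>N\<close> against \<open>M\<close> inside
  \<open>B\<close>. The bases have product 2, the source of the decay \<open>2 ^ (- mu B)\<close>,
  while their mean under the coin is still below 1 for \<open>p = 24 / 25\<close>.\<close>

definition drift :: "'a set \<Rightarrow> 'a set \<Rightarrow> 'a set \<Rightarrow> real" where
  "drift B M N = 10 ^ card (N \<inter> B) * (1 / 5) ^ card (M \<inter> B)"

lemma drift_pos: "0 < drift B M N"
  by (simp add: drift_def)

lemma drift_insert:
  assumes "state M N R" "considers M R u"
  shows "drift B (insert u M) N = (if u \<in> B then drift B M N / 5 else drift B M N)"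
    and "drift B M (insert u N) = (if u \<in> B then 10 * drift B M N else drift B M N)"
  using considersD(3,4)[OF assms] state_finite[OF assms(1)] by (auto simp: drift_def)

text \<open>The gains of the considered elements decrease along the process, while \<open>drift\<close> shrinks
  in expectation by the factor \<open>p / 5 + 10 * (1 - p) = 0.592\<close> at each element of \<open>B\<close>.\<close>

lemma drift_step:
  assumes "p = 24 / 25" "state M N R" "considers M R u" "0 \<le> W"
    and "e1 \<le> 5 / 2 * (W * drift B (insert u M) N)" "e2 \<le> 5 / 2 * (W * drift B M (insert u N))"
  shows "(if u \<in> B then W * drift B M N else 0) + (p * e1 + (1 - p) * e2) \<le> 5 / 2 * (W * drift B M N)"
proof -
  have "p * e1 + (1 - p) * e2 \<le>
      p * (5 / 2 * (W * drift B (insert u M) N)) + (1 - p) * (5 / 2 * (W * drift B M (insert u N)))"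
    using assms(5,6) p by (intro add_mono mult_left_mono) auto
  moreover have "0 \<le> W * drift B M N" using assms(4) drift_pos[of B M N] by simp
  \<comment> \<open>For \<open>u\<close> in \<open>B\<close> the left side is at most
    \<open>1 + 5 / 2 * 0.592 = 2.48\<close> times \<open>W * drift B M N\<close>; this is what the
    constant \<open>5 / 2\<close> has to exceed.\<close>
  ultimately show ?thesis
    by (simp add: drift_insert[OF assms(2,3)] assms(1) split: if_splits)
qed

text \<open>A geometric series with ratio 0.592. The bound \<open>W\<close> persists because the
  candidates only become fewer and their gains only smaller as \<open>M\<close> grows.\<close>

lemma gain_drift_le:
  assumes p_eq: "p = 24 / 25" and "state M N R" "\<And>v. v \<in> cnd M R \<Longrightarrow> gain M v \<le> W" "0 \<le> W"
  shows "path_exp (tsum (\<lambda>M N u b. if u \<in> B then gain M u * drift B M N else 0)) M N R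
    \<le> 5 / 2 * (W * drift B M N)"
  using assms(2,3)
proof (induction rule: process_induct)
  case (stop M N R)
  then show ?case using assms(4) drift_pos[of B M N] by (simp add: path_exp_stop)
next
  case (step M N R u)
  note d = considersD[OF step(1,2)]
  let ?E = "path_exp (tsum (\<lambda>M N u b. if u \<in> B then gain M u * drift B M N else 0))"
  have 1: "?E (insert u M) N (R - {u}) \<le> 5 / 2 * (W * drift B (insert u M) N)"
  proof (rule step(3))
    fix v assume "v \<in> cnd (insert u M) (R - {u})"
    then have v: "v \<in> R" "ind (insert v (insert u M))" by (auto simp: cand_def)
    have "ind (insert v M)" by (rule indep_subset[OF v(2)]) auto
    then have "gain M v \<le> W" using v(1) by (intro step(5)) (simp add: cand_def)
    moreover have "gain (insert u M) v \<le> gain M v"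
      using d v(1) step(1) by (intro gain_antimono) (auto simp: state_def)
    ultimately show "gain (insert u M) v \<le> W" by simp
  qed
  have 2: "?E M (insert u N) (R - {u}) \<le> 5 / 2 * (W * drift B M (insert u N))"
    by (rule step(4)) (auto intro!: step(5) simp: cand_def)
  have w: "gain M u * drift B M N \<le> W * drift B M N"
    using d(1,5) drift_pos[of B M N] by (intro mult_right_mono step(5)) (auto simp: cand_def)
  have "?E M N R = (if u \<in> B then gain M u * drift B M N else 0) +
      (p * ?E (insert u M) N (R - {u}) + (1 - p) * ?E M (insert u N) (R - {u}))"
    by (rule path_exp_tsum_step_unlabelled[OF step(1,2)])
  then show ?case
    using drift_step[OF p_eq step(1,2) assms(4) 1 2] w by (simp split: if_splits)
qed

text \<open>Until the first element of \<open>B\<close> is considered, \<open>drift\<close> stays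
  constant. From then on \<open>gain_drift_le\<close> applies with \<open>W\<close> the gain of that
  element, which alone is at most the sum of all gains in \<open>B\<close>.\<close>

lemma gain_drift_le_gain:
  assumes p_eq: "p = 24 / 25" and "state M N R"
  shows "path_exp (tsum (\<lambda>M N u b. if u \<in> B then gain M u * drift B M N else 0)) M N R
    \<le> 5 / 2 * (drift B M N * path_exp (tsum (\<lambda>M N u b. if u \<in> B then gain M u else 0)) M N R)"
  using assms(2)
proof (induction rule: process_induct)
  case (stop M N R)
  then show ?case by (simp add: path_exp_stop)
next
  case (step M N R u)
  note d = considersD[OF step(1,2)]
  let ?E = "path_exp (tsum (\<lambda>M N u b. if u \<in> B then gain M u * drift B M N else 0))"
  let ?G = "path_exp (tsum (\<lambda>M N u b. if u \<in> B then gain M u else 0))"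
  have w0: "0 \<le> gain M u" using d by (intro gain_nonneg)
  have G: "0 \<le> ?G (insert u M) N (R - {u})" "0 \<le> ?G M (insert u N) (R - {u})"
    by (rule path_exp_tsum_nonneg; use d(9,10) in \<open>simp add: gain_nonneg\<close>)+
  show ?case
  proof (cases "u \<in> B")
    case True
    have 1: "?E (insert u M) N (R - {u}) \<le> 5 / 2 * (gain M u * drift B (insert u M) N)"
    proof (rule gain_drift_le[OF p_eq d(9) _ w0])
      fix v assume "v \<in> cnd (insert u M) (R - {u})"
      then have v: "v \<in> R" "ind (insert v (insert u M))" by (auto simp: cand_def)
      have "ind (insert v M)" by (rule indep_subset[OF v(2)]) auto
      then have "gain M v \<le> gain M u" using v(1) by (intro considersD(8)[OF step(1,2)]) (simp add: cand_def)
      moreover have "gain (insert u M) v \<le> gain M v"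
        using d v(1) step(1) by (intro gain_antimono) (auto simp: state_def)
      ultimately show "gain (insert u M) v \<le> gain M u" by simp
    qed
    have 2: "?E M (insert u N) (R - {u}) \<le> 5 / 2 * (gain M u * drift B M (insert u N))"
      by (rule gain_drift_le[OF p_eq d(10) _ w0])
        (auto intro!: considersD(8)[OF step(1,2)] simp: cand_def)
    have "?E M N R = gain M u * drift B M N +
        (p * ?E (insert u M) N (R - {u}) + (1 - p) * ?E M (insert u N) (R - {u}))"
      using True by (subst path_exp_tsum_step_unlabelled[OF step(1,2)]) simp
    then have "?E M N R \<le> 5 / 2 * (drift B M N * gain M u)"
      using drift_step[OF p_eq step(1,2) w0 1 2] True by (simp add: mult.commute)
    moreover have "gain M u \<le> ?G M N R"
    proof -
      have "?G M N R = gain M u + (p * ?G (insert u M) N (R - {u}) + (1 - p) * ?G M (insert u N) (R - {u}))"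
        using True by (subst path_exp_tsum_step_unlabelled[OF step(1,2)]) simp
      moreover have "0 \<le> p * ?G (insert u M) N (R - {u}) + (1 - p) * ?G M (insert u N) (R - {u})"
        using G p by (intro add_nonneg_nonneg mult_nonneg_nonneg) auto
      ultimately show ?thesis by linarith
    qed
    then have "drift B M N * gain M u \<le> drift B M N * ?G M N R"
      using drift_pos[of B M N] by (intro mult_left_mono) auto
    ultimately show ?thesis by linarith
  next
    case False
    have "p * ?E (insert u M) N (R - {u}) + (1 - p) * ?E M (insert u N) (R - {u})
      \<le> p * (5 / 2 * (drift B M N * ?G (insert u M) N (R - {u})))
        + (1 - p) * (5 / 2 * (drift B M N * ?G M (insert u N) (R - {u})))"
      using step(3,4) False p
      by (intro add_mono mult_left_mono) (auto simp: drift_insert[OF step(1,2)])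
    also have "\<dots> = 5 / 2 * (drift B M N *
        (p * ?G (insert u M) N (R - {u}) + (1 - p) * ?G M (insert u N) (R - {u})))"
      by algebra
    finally show ?thesis
      unfolding path_exp_tsum_step_unlabelled[OF step(1,2)] using False by simp
  qed
qed

text \<open>An upper bound for the probability that more than \<open>k\<close> elements of \<open>B\<close> end in the set \<open>N\<close>:
  while \<open>N\<close> does not exceed \<open>k\<close>, no element of \<open>B\<close> is considered once \<open>M\<close> has reached \<open>k\<close>.\<close>

definition risk :: "nat \<Rightarrow> 'a set \<Rightarrow> 'a set \<Rightarrow> 'a set \<Rightarrow> real" where
  "risk k B M N = (if k < card (N \<inter> B) then 1 else if k \<le> card (M \<inter> B) then 0
     else (1 / 50) * (1 / 2) ^ k * drift B M N)"

text \<open>With at least \<open>k + 1\<close> elements in \<open>N\<close> and at most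
  \<open>k - 1\<close> in \<open>M\<close>, the drift is at least
  \<open>10 ^ (k + 1) / 5 ^ (k - 1) = 50 * 2 ^ k\<close>. The factor \<open>1 / 50\<close> in
  \<open>risk\<close> normalises this to 1.\<close>

lemma risk_le_drift:
  assumes "card (M \<inter> B) < k"
  shows "risk k B M N \<le> (1 / 50) * (1 / 2) ^ k * drift B M N"
proof (cases "k < card (N \<inter> B)")
  case True
  obtain j where j: "k = Suc j" using assms by (cases k) auto
  have "(10::real) ^ Suc k \<le> 10 ^ card (N \<inter> B)" using True by (intro power_increasing) auto
  moreover have "(1 / 5 :: real) ^ j \<le> (1 / 5) ^ card (M \<inter> B)"
    using assms j by (intro power_decreasing) auto
  ultimately have "10 ^ Suc k * (1 / 5) ^ j \<le> drift B M N"
    unfolding drift_def by (intro mult_mono) auto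
  then have "(1 / 50) * (1 / 2) ^ k * (10 ^ Suc k * (1 / 5) ^ j) \<le> (1 / 50) * (1 / 2) ^ k * drift B M N"
    by (intro mult_left_mono) auto
  moreover have "(1 / 50) * (1 / 2) ^ k * (10 ^ Suc k * (1 / 5) ^ j) = (1 / 2 * 10 * (1 / 5) :: real) ^ j"
    unfolding j power_mult_distrib by simp
  moreover have "(1 / 2 * 10 * (1 / 5) :: real) ^ j = 1" by simp
  ultimately have "1 \<le> (1 / 50) * (1 / 2) ^ k * drift B M N" by linarith
  then show ?thesis using True by (simp only: risk_def if_True)
next
  case False
  then show ?thesis using assms by (simp add: risk_def)
qed

text \<open>\<open>X\<close> stands for the gain that \<open>N\<close> has already collected in
  \<open>B\<close>. It is charged at the current risk, which does not increase in expectation. A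
  newly collected gain is charged at the risk after \<open>u\<close> has joined \<open>N\<close>,
  where the drift has grown by 10; hence \<open>10 / 50 = 1 / 5\<close>.\<close>

lemma overflow_le_drift:
  assumes p_eq: "p = 24 / 25" and B: "B \<in> F" "mu B = k" and "state M N R" "0 \<le> X"
  shows "path_exp (\<lambda>l. (X + tsum (\<lambda>M N u b. if b = False then if u \<in> B then gain M u else 0 else 0) l) *
      of_bool (k < card ((N \<union> picked False l) \<inter> B))) M N R
    \<le> X * risk k B M N + (1 - p) * ((1 / 5) * (1 / 2) ^ k) *
        path_exp (tsum (\<lambda>M N u b. if u \<in> B then gain M u * drift B M N else 0)) M N R"
  using assms(4,5)
proof (induction arbitrary: X rule: process_induct)
  case (stop M N R)
  have "0 \<le> risk k B M N" using drift_pos[of B M N] by (simp add: risk_def)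
  then show ?case using stop by (auto simp: path_exp_stop risk_def)
next
  case (step M N R u)
  note d = considersD[OF step(1,2)]
  note fin = state_finite[OF step(1)]
  let ?L = "\<lambda>X M N R. path_exp (\<lambda>l. (X + tsum (\<lambda>M N u b. if b = False then if u \<in> B then gain M u else 0 else 0) l) *
      of_bool (k < card ((N \<union> picked False l) \<inter> B))) M N R"
  let ?E = "path_exp (tsum (\<lambda>M N u b. if u \<in> B then gain M u * drift B M N else 0))"
  let ?c = "(1 - p) * ((1 / 5) * (1 / 2) ^ k)"
  have w0: "0 \<le> gain M u" using d by (intro gain_nonneg)
  show ?case
  proof (cases "u \<in> B")
    case True
    have "card (insert u M \<inter> B) \<le> k" using d(5) B by (auto simp: laminar_indep_def)
    \<comment> \<open>An element of \<open>B\<close> that can still be considered shows that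
      \<open>M\<close> has not filled \<open>B\<close>, so \<open>risk\<close> is governed by the
      drift.\<close>
    then have a: "card (M \<inter> B) < k" using True d(3) fin by simp
    have L: "?L X M N R = p * ?L X (insert u M) N (R - {u}) + (1 - p) * ?L (X + gain M u) M (insert u N) (R - {u})"
      using True by (simp add: path_exp_step[OF step(1,2)] add.assoc)
    have 1: "?L X (insert u M) N (R - {u}) \<le> X * risk k B (insert u M) N + ?c * ?E (insert u M) N (R - {u})"
      by (rule step(3)) (rule step(5))
    have 2: "?L (X + gain M u) M (insert u N) (R - {u})
        \<le> (X + gain M u) * risk k B M (insert u N) + ?c * ?E M (insert u N) (R - {u})"
      by (rule step(4)) (use step(5) w0 in simp)
    have r2: "risk k B M (insert u N) \<le> (1 / 5) * (1 / 2) ^ k * drift B M N"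
      using risk_le_drift[OF a, of "insert u N"] True by (simp add: drift_insert[OF step(1,2)] mult.commute)
    \<comment> \<open>Supermartingale property: \<open>p / 250 + (1 - p) / 5 = 0.592 / 50\<close>,
      below \<open>1 / 50\<close>. When \<open>M\<close> reaches \<open>k\<close> the risk even
      drops to 0.\<close>
    have r1: "p * risk k B (insert u M) N + (1 - p) * risk k B M (insert u N) \<le> risk k B M N"
    proof (cases "k < card (N \<inter> B)")
      case k: True
      then show ?thesis using True fin d(4) p by (simp add: risk_def)
    next
      case False
      have "risk k B (insert u M) N \<le> (1 / 50) * (1 / 2) ^ k * (drift B M N / 5)"
        using False True drift_pos[of B M N] by (simp add: risk_def drift_insert[OF step(1,2)])
      moreover have "risk k B M N = (1 / 50) * (1 / 2) ^ k * drift B M N"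
        using False a by (simp add: risk_def)
      moreover have "0 < (1 / 2) ^ k * drift B M N" using drift_pos[of B M N] by simp
      ultimately show ?thesis using r2 by (simp add: p_eq)
    qed
    have "?L X M N R \<le> p * (X * risk k B (insert u M) N + ?c * ?E (insert u M) N (R - {u}))
        + (1 - p) * ((X + gain M u) * risk k B M (insert u N) + ?c * ?E M (insert u N) (R - {u}))"
      unfolding L using 1 2 p by (intro add_mono mult_left_mono) auto
    also have "\<dots> = X * (p * risk k B (insert u M) N + (1 - p) * risk k B M (insert u N))
        + (1 - p) * gain M u * risk k B M (insert u N)
        + ?c * (p * ?E (insert u M) N (R - {u}) + (1 - p) * ?E M (insert u N) (R - {u}))"
      by algebra
    also have "\<dots> \<le> X * risk k B M N
        + (1 - p) * gain M u * ((1 / 5) * (1 / 2) ^ k * drift B M N)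
        + ?c * (p * ?E (insert u M) N (R - {u}) + (1 - p) * ?E M (insert u N) (R - {u}))"
      using r1 r2 step(5) w0 p by (intro add_mono mult_left_mono order.refl) auto
    also have "\<dots> = X * risk k B M N + ?c * ?E M N R"
    proof -
      have E: "?E M N R = gain M u * drift B M N +
          (p * ?E (insert u M) N (R - {u}) + (1 - p) * ?E M (insert u N) (R - {u}))"
        using True by (subst path_exp_tsum_step_unlabelled[OF step(1,2)]) simp
      show ?thesis unfolding E by algebra
    qed
    finally show ?thesis .
  next
    case False
    have r: "risk k B (insert u M) N = risk k B M N" "risk k B M (insert u N) = risk k B M N"
      using False by (auto simp: risk_def drift_insert[OF step(1,2)])
    have L: "?L X M N R = p * ?L X (insert u M) N (R - {u}) + (1 - p) * ?L X M (insert u N) (R - {u})"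
      using False by (simp add: path_exp_step[OF step(1,2)])
    have "?L X M N R \<le> p * (X * risk k B M N + ?c * ?E (insert u M) N (R - {u}))
        + (1 - p) * (X * risk k B M N + ?c * ?E M (insert u N) (R - {u}))"
      unfolding L using step(3)[OF step(5)] step(4)[OF step(5)] p r
      by (intro add_mono mult_left_mono) auto
    also have "\<dots> = X * risk k B M N + ?c * ?E M N R"
    proof -
      have E: "?E M N R = p * ?E (insert u M) N (R - {u}) + (1 - p) * ?E M (insert u N) (R - {u})"
        using False by (subst path_exp_tsum_step_unlabelled[OF step(1,2)]) simp
      show ?thesis unfolding E by algebra
    qed
    finally show ?thesis .
  qed
qed

text \<open>At the start nothing is collected and the drift is 1; the constants combine to
  \<open>1 / 5 * 5 / 2 = 1 / 2\<close>.\<close>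

lemma overflow_loss:
  assumes p_eq: "p = 24 / 25" and B: "B \<in> F"
  shows "path_exp (\<lambda>l. tsum (\<lambda>M N u b. if b = False then if u \<in> B then gain M u else 0 else 0) l *
      of_bool (mu B < card (picked False l \<inter> B))) {} {} U
    \<le> (1 - p) / 2 * ((1 / 2) ^ mu B * path_exp (tsum (\<lambda>M N u b. if u \<in> B then gain M u else 0)) {} {} U)"
proof -
  have s: "state {} {} U" by (simp add: state_def)
  let ?E = "path_exp (tsum (\<lambda>M N u b. if u \<in> B then gain M u * drift B M N else 0)) {} {} U"
  have "?E \<le> 5 / 2 * path_exp (tsum (\<lambda>M N u b. if u \<in> B then gain M u else 0)) {} {} U"
    using gain_drift_le_gain[OF p_eq s, of B] by (simp add: drift_def)
  then have "(1 - p) * ((1 / 5) * (1 / 2) ^ mu B) * ?E \<le> (1 - p) * ((1 / 5) * (1 / 2) ^ mu B) *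
      (5 / 2 * path_exp (tsum (\<lambda>M N u b. if u \<in> B then gain M u else 0)) {} {} U)"
    using p by (intro mult_left_mono) auto
  also have "\<dots> = (1 - p) / 2 * ((1 / 2) ^ mu B *
      path_exp (tsum (\<lambda>M N u b. if u \<in> B then gain M u else 0)) {} {} U)"
    by simp
  finally show ?thesis
    using overflow_le_drift[OF p_eq B refl s, of 0] by simp
qed

subsection \<open>The expected value of the elements that cannot overflow\<close>

lemma run_entry:
  assumes "state M N R" "(M', N', u, b) \<in> set (run M N R H)"
  shows "M' \<subseteq> U \<and> N' \<subseteq> U \<and> u \<in> U \<and> ind (insert u M')"
  using assms
proof (induction rule: process_induct)
  case (stop M N R)
  then show ?case by (simp add: trace_stop)
next
  case (step M N R u)
  then show ?case
    using considersD(2,5,6,7)[OF step(1,2)] by (auto simp: run_step split: if_splits)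
qed

lemma picked_run_subset: "picked b (run M N U H) \<subseteq> U"
  using picked_trace_subset[of b ind idx f M N U H] by auto

text \<open>Telescoping, as \<open>M\<close> changes only at the sampled elements.\<close>

lemma tsum_gain_accepted:
  assumes "state M N R"
  shows "tsum (\<lambda>M N u b. if b = True then gain M u else 0) (run M N R H)
    = f (M \<union> picked True (run M N R H)) - f M"
  using assms
proof (induction rule: process_induct)
  case (stop M N R)
  then show ?case by (simp add: trace_stop)
next
  case (step M N R u)
  then show ?case by (simp add: run_step gain_def)
qed

lemma tsum_gain_considered:
  assumes "state M N R"
  shows "tsum (\<lambda>M N u b. gain (M \<union> N) u) (run M N R H)
    = f (M \<union> N \<union> picked True (run M N R H) \<union> picked False (run M N R H)) - f (M \<union> N)"
  using assms
proof (induction rule: process_induct)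
  case (stop M N R)
  then show ?case by (simp add: trace_stop)
next
  case (step M N R u)
  then show ?case by (simp add: run_step gain_def)
qed

text \<open>A gain over \<open>M \<union> N\<close> is at most the gain over
  \<open>N \<inter> G\<close>. The bound holds for each run and each \<open>G\<close> separately, so
  \<open>G\<close> may later depend on the whole run.\<close>

lemma value_rejected_subset:
  assumes "state M N R"
  shows "f (N \<inter> G) + tsum (\<lambda>M N u b. if b = False then if u \<in> G then gain (M \<union> N) u else 0 else 0) (run M N R H)
    \<le> f ((N \<union> picked False (run M N R H)) \<inter> G)"
  using assms
proof (induction rule: process_induct)
  case (stop M N R)
  then show ?case by (simp add: trace_stop)
next
  case (step M N R u)
  note d = considersD[OF step(1,2)]
  have "gain (M \<union> N) u \<le> gain (N \<inter> G) u" using d by (intro gain_antimono) auto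
  then have "f (N \<inter> G) + (if u \<in> G then gain (M \<union> N) u else 0) \<le> f (insert u N \<inter> G)"
    by (simp add: gain_def)
  then show ?case
    using step(3,4) by (cases "u \<in> H") (simp_all add: run_step[OF step(1,2)])
qed

text \<open>These elements are accepted in every arrival order with this sample: even if all of
  \<open>N\<close> were accepted, no set around them would overflow.\<close>

definition good :: "('a set \<times> 'a set \<times> 'a \<times> bool) list \<Rightarrow> 'a set" where
  "good l = {u \<in> picked False l. \<forall>B\<in>F. u \<in> B \<longrightarrow> card (picked False l \<inter> B) \<le> mu B}"

text \<open>The remaining constraints of \<open>F\<close> are redundant, and by laminarity the essential sets containing
  a given element have pairwise distinct capacities.\<close>

definition essential :: "'a set set" where
  "essential = {B \<in> F. 0 < mu B \<and> (\<forall>B'\<in>F. B \<subset> B' \<longrightarrow> mu B < mu B')}"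

lemma finite_F: "finite F"
  using laminar by (simp add: laminar_family_def)

lemma finite_essential: "finite essential"
  using finite_F by (simp add: essential_def)

lemma essential_weight:
  shows "(\<Sum>B | B \<in> essential \<and> u \<in> B. (1 / 2) ^ mu B) \<le> (1 :: real)"
proof -
  let ?C = "{B. B \<in> essential \<and> u \<in> B}"
  have "inj_on mu ?C"
  proof (rule inj_onI)
    fix B B' assume *: "B \<in> ?C" "B' \<in> ?C" "mu B = mu B'"
    then have "B \<subseteq> B' \<or> B' \<subseteq> B"
      using laminar unfolding laminar_family_def essential_def by blast
    then show "B = B'" using * by (auto simp: essential_def)
  qed
  then have "(\<Sum>B\<in>?C. (1 / 2) ^ mu B) = (\<Sum>k\<in>mu ` ?C. (1 / 2 :: real) ^ k)"
    by (simp add: sum.reindex)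
  also have "\<dots> \<le> 1"
  proof (rule sum_half_powers_le)
    show "finite (mu ` ?C)" using finite_essential by simp
    show "0 \<notin> mu ` ?C" by (auto simp: essential_def)
  qed
  finally show ?thesis .
qed

text \<open>Take a largest overflowing set around \<open>u\<close>. A proper superset in
  \<open>F\<close> of no larger capacity would overflow as well, so this set is essential; its
  capacity is positive because \<open>u\<close> could be added to \<open>M\<close>.\<close>

lemma not_good_overflow:
  assumes "l = run {} {} U H" "u \<in> picked False l" "u \<notin> good l"
  shows "\<exists>B\<in>essential. u \<in> B \<and> mu B < card (picked False l \<inter> B)"
proof -
  let ?N = "picked False l"
  let ?V = "{B \<in> F. u \<in> B \<and> mu B < card (?N \<inter> B)}"
  have fN: "finite ?N" using picked_run_subset fin_U finite_subset assms(1) by metis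
  have "?V \<noteq> {}" using assms by (auto simp: good_def not_le)
  then have "Max (card ` ?V) \<in> card ` ?V" using finite_F by (intro Max_in) auto
  then obtain B where B: "B \<in> ?V" "card B = Max (card ` ?V)" by auto
  have max: "card B' \<le> card B" if "B' \<in> ?V" for B'
    using that finite_F B(2) by simp
  have "mu B < mu B'" if B': "B' \<in> F" "B \<subset> B'" for B'
  proof (rule ccontr)
    assume "\<not> mu B < mu B'"
    moreover have "card (?N \<inter> B) \<le> card (?N \<inter> B')" using B' fN by (intro card_mono) auto
    ultimately have "B' \<in> ?V" using B B' by auto
    moreover have "finite B'"
      using B'(1) laminar finite_subset[OF _ fin_U, of B'] by (simp add: laminar_family_def)
    then have "card B < card B'" using B'(2) by (rule psubset_card_mono)
    ultimately show False using max[of B'] by linarith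
  qed
  moreover have "0 < mu B"
  proof -
    obtain M N where "(M, N, u, False) \<in> set l" using assms(2) by (auto simp: picked_def)
    then have i: "insert u M \<subseteq> U" "ind (insert u M)"
      using run_entry[of "{}" "{}" U M N u False H] assms(1) by (auto simp: state_def)
    have "finite (insert u M \<inter> B)" "u \<in> insert u M \<inter> B"
      using finite_subset[OF i(1) fin_U] B(1) by auto
    then have "card (insert u M \<inter> B) \<noteq> 0" using card_0_eq by blast
    moreover have "card (insert u M \<inter> B) \<le> mu B" using i(2) B(1) by (auto simp: laminar_indep_def)
    ultimately show ?thesis by simp
  qed
  ultimately show ?thesis using B by (auto simp: essential_def)
qed

text \<open>Each element of \<open>N\<close> outside \<open>good l\<close> is charged to an
  overflowing essential set around it, at its gain over \<open>M\<close>, which is at least the gain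
  over \<open>M \<union> N\<close> that is lost.\<close>

lemma value_good:
  assumes l: "l = run {} {} U H"
  shows "f {} + (tsum (\<lambda>M N u b. if b = False then gain (M \<union> N) u else 0) l
     - (\<Sum>B\<in>essential. tsum (\<lambda>M N u b. if b = False then if u \<in> B then gain M u else 0 else 0) l *
          of_bool (mu B < card (picked False l \<inter> B)))) \<le> f (good l)"
proof -
  have s: "state {} {} U" by (simp add: state_def)
  let ?o = "\<lambda>B. of_bool (mu B < card (picked False l \<inter> B)) :: real"
  let ?d = "\<lambda>B M N u b. if b = False then if u \<in> B then gain M u else 0 else 0"
  have "tsum (\<lambda>M N u b. (if b = False then gain (M \<union> N) u else 0) - (\<Sum>B\<in>essential. ?d B M N u b * ?o B)) l
    \<le> tsum (\<lambda>M N u b. if b = False then if u \<in> good l then gain (M \<union> N) u else 0 else 0) l"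
  proof (rule tsum_mono)
    fix M N u b assume e: "(M, N, u, b) \<in> set l"
    then have U: "M \<subseteq> U" "N \<subseteq> U" "u \<in> U" using run_entry[OF s] l by blast+
    have d: "0 \<le> ?d B M N u b * ?o B" for B using U gain_nonneg by simp
    then have d': "0 \<le> (\<Sum>B\<in>essential. ?d B M N u b * ?o B)" by (rule sum_nonneg)
    show "(if b = False then gain (M \<union> N) u else 0) - (\<Sum>B\<in>essential. ?d B M N u b * ?o B)
      \<le> (if b = False then if u \<in> good l then gain (M \<union> N) u else 0 else 0)"
    proof (cases "b = False \<and> u \<notin> good l")
      case True
      then have "u \<in> picked False l" using e by (auto simp: picked_def)
      then obtain B where B: "B \<in> essential" "u \<in> B" "mu B < card (picked False l \<inter> B)"
        using not_good_overflow[OF l] True by blast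
      have "gain (M \<union> N) u \<le> gain M u" using U by (intro gain_antimono) auto
      also have "\<dots> = ?d B M N u b * ?o B" using B True by simp
      also have "\<dots> \<le> (\<Sum>B\<in>essential. ?d B M N u b * ?o B)"
        using B(1) d finite_essential by (intro member_le_sum) auto
      finally show ?thesis using True by simp
    next
      case False
      then show ?thesis using d' by auto
    qed
  qed
  moreover have "f {} + tsum (\<lambda>M N u b. if b = False then if u \<in> good l then gain (M \<union> N) u else 0 else 0) l \<le> f (good l)"
  proof -
    have "picked False l \<inter> good l = good l" by (auto simp: good_def)
    then show ?thesis using value_rejected_subset[OF s, of "good l" H] l by simp
  qed
  ultimately show ?thesis by (simp only: tsum_diff tsum_sum)
qed

lemma expected_value_good:
  assumes p_eq: "p = 24 / 25" and Z: "ind Z"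
  shows "f Z / 211 \<le> sample_exp p U (\<lambda>H. f (good (run {} {} U H)))"
proof -
  have s: "state {} {} U" by (simp add: state_def)
  let ?E = "\<lambda>\<phi>. path_exp \<phi> {} {} U"
  let ?d = "\<lambda>B M N u b. if b = False then if u \<in> B then gain M u else 0 else 0"
  let ?loss = "\<lambda>B l. tsum (?d B) l * of_bool (mu B < card (picked False l \<inter> B))"
  let ?g = "\<lambda>B M N u b. if u \<in> B then gain M u else 0"
  define Y where "Y = ?E (\<lambda>l. f (picked True l)) - f {}"
  define S where "S = ?E (tsum (\<lambda>M N u b. gain M u))"
  have const: "?E (\<lambda>l. \<phi> l - c) = ?E \<phi> - c" for \<phi> c
    using fin_U by (simp add: path_exp_def sample_exp_diff sample_exp_const)

  have greedy: "f Z - f {} \<le> 2 * Y"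
  proof -
    have "1 / 2 \<le> p" "Z \<subseteq> U" using p_eq Z by (auto simp: laminar_indep_def)
    then show ?thesis using greedy_value[OF _ s, of Z] Z by (simp add: Y_def)
  qed
  have YS: "Y = p * S"
  proof -
    have "p * S = ?E (tsum (\<lambda>M N u b. if b = True then gain M u else 0))"
      unfolding S_def using path_exp_label[OF s, of True "\<lambda>M N u. gain M u"] by simp
    also have "\<dots> = ?E (\<lambda>l. f (picked True l) - f {})"
      unfolding path_exp_def using tsum_gain_accepted[OF s] by simp
    finally show ?thesis by (simp add: Y_def const)
  qed
  \<comment> \<open>Adding \<open>N\<close> to \<open>M\<close> loses no value, the gains over
    \<open>M \<union> N\<close> telescope, and by independence of the labels a fraction
    \<open>1 - p\<close> of them falls to \<open>N\<close>.\<close>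
  have gains: "(1 - p) * Y \<le> ?E (tsum (\<lambda>M N u b. if b = False then gain (M \<union> N) u else 0))"
  proof -
    have "Y = ?E (\<lambda>l. f (picked True l) - f {})" by (simp add: Y_def const)
    also have "\<dots> \<le> ?E (\<lambda>l. f (picked True l \<union> picked False l) - f {})"
      unfolding path_exp_def using p
      by (intro sample_exp_mono diff_mono f_mono Un_least picked_run_subset) auto
    also have "\<dots> = ?E (tsum (\<lambda>M N u b. gain (M \<union> N) u))"
      unfolding path_exp_def using tsum_gain_considered[OF s] by simp
    finally have "(1 - p) * Y \<le> (1 - p) * ?E (tsum (\<lambda>M N u b. gain (M \<union> N) u))"
      using p by (intro mult_left_mono) auto
    then show ?thesis using path_exp_label[OF s, of False "\<lambda>M N u. gain (M \<union> N) u"] by simp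
  qed
  have losses: "(\<Sum>B\<in>essential. ?E (?loss B)) \<le> (1 - p) / 2 * S"
  proof -
    have "(\<Sum>B\<in>essential. ?E (?loss B)) \<le> (\<Sum>B\<in>essential. (1 - p) / 2 * ((1 / 2) ^ mu B * ?E (tsum (?g B))))"
      using overflow_loss[OF p_eq] by (intro sum_mono) (auto simp: essential_def)
    also have "\<dots> = (1 - p) / 2 * (\<Sum>B\<in>essential. ?E (\<lambda>l. tsum (?g B) l * (1 / 2) ^ mu B))"
      unfolding path_exp_def sum_distrib_left
      by (intro sum.cong refl) (simp add: mult.commute sample_exp_cmult[of p U "(1 / 2) ^ mu _"])
    also have "(\<Sum>B\<in>essential. ?E (\<lambda>l. tsum (?g B) l * (1 / 2) ^ mu B))
        = ?E (tsum (\<lambda>M N u b. \<Sum>B\<in>essential. ?g B M N u b * (1 / 2) ^ mu B))"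
      unfolding path_exp_def sample_exp_sum[symmetric] tsum_sum ..
    also have "(1 - p) / 2 * \<dots> \<le> (1 - p) / 2 * S"
    proof (rule mult_left_mono)
      show "?E (tsum (\<lambda>M N u b. \<Sum>B\<in>essential. ?g B M N u b * (1 / 2) ^ mu B)) \<le> S"
        unfolding S_def path_exp_def
      proof (intro sample_exp_mono tsum_mono)
        fix H M N u b assume "(M, N, u, b) \<in> set (run {} {} U H)"
        then have g: "0 \<le> gain M u" using run_entry[OF s, of M N u b H] by (simp add: gain_nonneg)
        \<comment> \<open>After exchanging the sums, each considered element carries total weight at
          most 1, so its gain is not counted more than once.\<close>
        have "(\<Sum>B\<in>essential. ?g B M N u b * (1 / 2) ^ mu B)
          = gain M u * (\<Sum>B | B \<in> essential \<and> u \<in> B. (1 / 2) ^ mu B)"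
          using finite_essential unfolding sum_distrib_left
          by (intro sum.mono_neutral_cong_right) auto
        also have "\<dots> \<le> gain M u" using g essential_weight by (simp add: mult_left_le)
        finally show "(\<Sum>B\<in>essential. ?g B M N u b * (1 / 2) ^ mu B) \<le> gain M u" .
      qed (use p in auto)
    qed (use p in auto)
    finally show ?thesis .
  qed
  have "f {} + (?E (tsum (\<lambda>M N u b. if b = False then gain (M \<union> N) u else 0)) - (\<Sum>B\<in>essential. ?E (?loss B)))
    = ?E (\<lambda>l. f {} + (tsum (\<lambda>M N u b. if b = False then gain (M \<union> N) u else 0) l - (\<Sum>B\<in>essential. ?loss B l)))"
    using fin_U
    by (simp add: path_exp_def sample_exp_add sample_exp_diff sample_exp_sum sample_exp_const)
  also have "\<dots> \<le> ?E (\<lambda>l. f (good l))"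
    unfolding path_exp_def using p value_good[OF refl] by (intro sample_exp_mono) auto
  finally have "f {} + ((1 - p) * Y - (1 - p) / 2 * S) \<le> ?E (\<lambda>l. f (good l))"
    using gains losses by linarith
  moreover have "0 \<le> f {}" by (rule f_nonneg) simp
  moreover have "0 \<le> S"
    unfolding S_def by (rule path_exp_tsum_nonneg[OF s]) (rule gain_nonneg)
  \<comment> \<open>\<open>p * (1 - p) - (1 - p) / 2 = 23 / 1250\<close>. The resulting ratio is
    \<open>2400 / 23\<close>, below 105, so 211 leaves ample room.\<close>
  moreover have "(1 - p) * Y - (1 - p) / 2 * S = 23 / 1250 * S" "2 * Y = 48 / 25 * S"
    unfolding YS p_eq by simp_all
  ultimately have "f Z / 211 \<le> ?E (\<lambda>l. f (good l))" using greedy by linarith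
  then show ?thesis by (simp only: path_exp_def)
qed

end

section \<open>The online algorithm\<close>

text \<open>\<open>ys\<close> includes the current element, so the strict
  \<open>m < length ys\<close> says that sampling is over.\<close>

definition greedy_rule ::
  "'a set \<Rightarrow> 'a set set \<Rightarrow> ('a set \<Rightarrow> nat) \<Rightarrow> ('a \<Rightarrow> nat) \<Rightarrow> nat \<Rightarrow> 'a decision_rule" where
  "greedy_rule U F mu idx m ys g A \<longleftrightarrow>
    m < length ys \<and> insert (last ys) A \<in> laminar_indep U F mu \<and>
    last ys \<in> picked False (trace (\<lambda>T. T \<in> laminar_indep U F mu) idx g {} {}
      (insert (last ys) (set (take m ys))) (set (take m ys)))"

definition greedy_alg :: "'a online_alg" where
  "greedy_alg U F mu =
    posterior_alg (binomial_pmf (card U) (24 / 25)) (greedy_rule U F mu (to_nat_on U))"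

section \<open>The accepted set for a fixed order and sample size\<close>

context laminar_process
begin

abbreviation "rule_run m \<equiv> run_det (greedy_rule U F mu idx m) f [] {}"

lemma greedy_rule_iff:
  assumes "distinct (ys @ x # zs)" "set (ys @ x # zs) = U"
  shows "greedy_rule U F mu idx m (ys @ [x]) (restrict f (Pow (set (ys @ [x])))) A \<longleftrightarrow>
    ind (insert x A) \<and> x \<in> picked False (run {} {} U (set (take m (ys @ x # zs))))"
proof (cases "m \<le> length ys")
  case True
  let ?H = "set (take m ys)" and ?g = "restrict f (Pow (set (ys @ [x])))"
  have H: "?H \<subseteq> set ys" by (rule set_take_subset)
  have "trace ind idx ?g {} {} (insert x ?H) ?H = run {} {} (insert x ?H) ?H"
    using H by (intro trace_cong_value) auto
  moreover have "x \<in> picked False (run {} {} (insert x ?H) ?H) \<longleftrightarrow> x \<in> picked False (run {} {} U ?H)"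
    using assms H by (intro rejected_restrict_ground[OF inj_idx fin_U]) auto
  ultimately show ?thesis using True by (simp add: greedy_rule_def)
next
  case False
  \<comment> \<open>An element that arrives during sampling belongs to the sample and can never
    carry the label \<open>False\<close>.\<close>
  then have "x \<in> set (take m (ys @ x # zs))" by (cases "m - length ys") auto
  then show ?thesis
    using False picked_trace_subset[of False ind idx f "{}" "{}" U "set (take m (ys @ x # zs))"]
    by (auto simp: greedy_rule_def)
qed

text \<open>Only elements of \<open>N\<close> are ever accepted. Hence a good element always fits:
  the sets containing it hold at most \<open>mu B\<close> elements of \<open>N\<close>, and the
  other sets are unaffected by it.\<close>

lemma rule_run_invariant:
  assumes "distinct (ys @ zs)" "set (ys @ zs) = U" and l: "l = run {} {} U (set (take m (ys @ zs)))"
  shows "ind (rule_run m ys) \<and> rule_run m ys \<subseteq> picked False l \<and> good l \<inter> set ys \<subseteq> rule_run m ys"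
  using assms
proof (induction ys arbitrary: zs rule: rev_induct)
  case Nil
  then show ?case by (simp add: laminar_indep_def)
next
  case (snoc x ys)
  let ?A = "rule_run m ys"
  have IH: "ind ?A" "?A \<subseteq> picked False l" "good l \<inter> set ys \<subseteq> ?A"
    using snoc.IH[of "x # zs"] snoc.prems by auto
  have run: "rule_run m (ys @ [x]) = (if ind (insert x ?A) \<and> x \<in> picked False l then insert x ?A else ?A)"
    using greedy_rule_iff[of ys x zs m ?A] snoc.prems by (simp add: run_det_append)
  have "ind (insert x ?A) \<and> x \<in> picked False l" if x: "x \<in> good l"
  proof -
    have xl: "x \<in> picked False l" using x by (simp add: good_def)
    have lU: "picked False l \<subseteq> U" using picked_run_subset snoc.prems(3) by simp
    have "card (insert x ?A \<inter> B) \<le> mu B" if B: "B \<in> F" for B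
    proof (cases "x \<in> B")
      case True
      have "card (insert x ?A \<inter> B) \<le> card (picked False l \<inter> B)"
        using IH(2) xl finite_subset[OF lU fin_U] by (intro card_mono) auto
      also have "\<dots> \<le> mu B" using x True B by (simp add: good_def)
      finally show ?thesis .
    next
      case False
      then show ?thesis using IH(1) B by (simp add: laminar_indep_def)
    qed
    then show ?thesis using xl lU IH(1) by (auto simp: laminar_indep_def)
  qed
  then show ?case using IH unfolding run by auto
qed

end

lemma greedy_alg_competitive:
  fixes U :: "'a set"
  assumes "finite U" "laminar_family U F" "nonneg_monotone_submodular U f"
  shows "\<forall>xs \<in> permutations_of_set U. \<forall>A \<in> set_pmf (run_online greedy_alg U F mu f [] {} xs).
      A \<in> laminar_indep U F mu"
    and "measure_pmf.expectation (alg_outcome greedy_alg U F mu f) f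
      \<ge> (1 / 211) * Max (f ` laminar_indep U F mu)"
proof -
  \<comment> \<open>\<open>to_nat_on U\<close> is a tie-breaking order fixed before any
    arrival.\<close>
  interpret laminar_process U F mu f "to_nat_on U" "24 / 25"
    using assms by unfold_locales (auto intro: inj_on_to_nat_on countable_finite)
  let ?P = "binomial_pmf (card U) (24 / 25)"
  let ?A = "\<lambda>xs m. rule_run m xs"
  have run: "run_online greedy_alg U F mu f [] {} xs = map_pmf (?A xs) ?P"
    if "xs \<in> permutations_of_set U" for xs
    using that by (intro run_online_posterior_alg) (auto simp: greedy_alg_def permutations_of_set_def)
  have inv: "ind (?A xs m)" "good (run {} {} U (set (take m xs))) \<subseteq> ?A xs m"
    if "xs \<in> permutations_of_set U" for xs m
  proof -
    have xs: "distinct xs" "set xs = U" using that by (auto simp: permutations_of_set_def)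
    have "good l \<subseteq> picked False l" for l by (auto simp: good_def)
    then have "good (run {} {} U (set (take m xs))) \<subseteq> U" using picked_run_subset by blast
    then show "ind (?A xs m)" "good (run {} {} U (set (take m xs))) \<subseteq> ?A xs m"
      using rule_run_invariant[of xs "[]" _ m] xs by auto
  qed
  show "\<forall>xs \<in> permutations_of_set U. \<forall>A \<in> set_pmf (run_online greedy_alg U F mu f [] {} xs).
      A \<in> laminar_indep U F mu"
    using run inv(1) by auto

  have fin: "finite (laminar_indep U F mu)"
  proof (rule finite_subset)
    show "laminar_indep U F mu \<subseteq> Pow U" by (auto simp: laminar_indep_def)
  qed (use fin_U in simp)
  have ne: "{} \<in> laminar_indep U F mu" by (simp add: laminar_indep_def)
  then have "Max (f ` laminar_indep U F mu) \<in> f ` laminar_indep U F mu"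
    using fin by (intro Max_in) auto
  then obtain Z where Z: "ind Z" "Max (f ` laminar_indep U F mu) = f Z" by auto
  let ?S = "pmf_of_set (permutations_of_set U)"
  have Sfin: "finite (permutations_of_set U)" "permutations_of_set U \<noteq> {}" using fin_U by auto
  have "f Z / 211 \<le> sample_exp (24 / 25) U (\<lambda>H. f (good (run {} {} U H)))"
    by (rule expected_value_good[OF refl Z(1)])
  also have "\<dots> = measure_pmf.expectation ?S
      (\<lambda>xs. measure_pmf.expectation ?P (\<lambda>m. f (good (run {} {} U (set (take m xs))))))"
    using fin_U by (subst binomial_prefix_expectation) auto
  also have "\<dots> \<le> measure_pmf.expectation ?S (\<lambda>xs. measure_pmf.expectation ?P (\<lambda>m. f (?A xs m)))"
  proof -
    have "measure_pmf.expectation ?P (\<lambda>m. f (good (run {} {} U (set (take m xs)))))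
        \<le> measure_pmf.expectation ?P (\<lambda>m. f (?A xs m))" if "xs \<in> permutations_of_set U" for xs
    proof (rule integral_mono)
      fix m
      have "?A xs m \<subseteq> U" using inv(1)[OF that] by (auto simp: laminar_indep_def)
      then show "f (good (run {} {} U (set (take m xs)))) \<le> f (?A xs m)"
        by (intro f_mono inv(2)[OF that])
    qed auto
    then show ?thesis
      unfolding integral_pmf_of_set[OF Sfin(2,1)] by (intro divide_right_mono sum_mono) auto
  qed
  also have "\<dots> = measure_pmf.expectation (?S \<bind> (\<lambda>xs. map_pmf (?A xs) ?P)) f"
  proof -
    have "finite (set_pmf (map_pmf (?A xs) ?P))" for xs by simp
    then have "measure_pmf.expectation (?S \<bind> (\<lambda>xs. map_pmf (?A xs) ?P)) f =
        (\<Sum>xs\<in>permutations_of_set U. measure_pmf.expectation (map_pmf (?A xs) ?P) f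
          /\<^sub>R real (card (permutations_of_set U)))"
      by (intro pmf_expectation_bind_pmf_of_set[OF Sfin(2,1)])
    then show ?thesis
      unfolding integral_pmf_of_set[OF Sfin(2,1)] sum_divide_distrib
      by (simp only: integral_map_pmf real_scaleR_def divide_inverse mult.commute)
  qed
  also have "?S \<bind> (\<lambda>xs. map_pmf (?A xs) ?P) = alg_outcome greedy_alg U F mu f"
    unfolding alg_outcome_def using run Sfin by (intro bind_pmf_cong) auto
  finally show "measure_pmf.expectation (alg_outcome greedy_alg U F mu f) f
      \<ge> (1 / 211) * Max (f ` laminar_indep U F mu)"
    using Z(2) by simp
qed

theorem theorem1:
  shows "\<exists>alg :: 'a online_alg. \<forall>(U :: 'a set) F mu f.
     finite U \<and> laminar_family U F \<and> nonneg_monotone_submodular U f \<longrightarrow>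
       (\<forall>xs \<in> permutations_of_set U. \<forall>A \<in> set_pmf (run_online alg U F mu f [] {} xs).
           A \<in> laminar_indep U F mu) \<and>
       measure_pmf.expectation (alg_outcome alg U F mu f) f
         \<ge> (1 / 211) * Max (f ` laminar_indep U F mu)"
  using greedy_alg_competitive by (intro exI[of _ greedy_alg]) blast

end
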